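(* For every fixed integer $c\ge 2$, \textsc{$c$-Closed Vertex Deletion} admits a kernel with $\mathcal{O}(k^{c+2})$ vertices that can be computed in $\mathcal{O}(n^3+n^2m)$ time, where $n$ and $m$ are the numbers of vertices and edges of the input graph.
   Context: A graph is $c$-closed if every pair of distinct nonadjacent vertices has at most $c-1$ common neighbors. \textsc{$c$-Closed Vertex Deletion}: given a graph $G=(V,E)$ and a positive integer $k$, decide whether there is $S\subseteq V$ with $|S|\le k$ such that $G-S$ is $c$-closed; the parameter is $k$. A kernel maps each instance $(G,k)$ to an equivalent instance $(G',k')$ whose size is bounded by a function of $k$. *)

theory Defs
  imports Main
begin

section \<open>Graphs and the deletion problem\<close>

type_synonym 'a graph = "'a set \<times> 'a set set"

abbreviation (input) verts :: "'a graph \<Rightarrow> 'a set" where "verts \<equiv> fst"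
abbreviation (input) edges :: "'a graph \<Rightarrow> 'a set set" where "edges \<equiv> snd"

definition simple_graph :: "'a graph \<Rightarrow> bool" where
  "simple_graph G \<longleftrightarrow> finite (verts G) \<and> edges G \<subseteq> {e. e \<subseteq> verts G \<and> card e = 2}"

definition adjacent :: "'a graph \<Rightarrow> 'a \<Rightarrow> 'a \<Rightarrow> bool" where
  "adjacent G u v \<longleftrightarrow> {u, v} \<in> edges G"

definition neighbors :: "'a graph \<Rightarrow> 'a \<Rightarrow> 'a set" where
  "neighbors G v = {u \<in> verts G. adjacent G u v}"

definition c_closed :: "nat \<Rightarrow> 'a graph \<Rightarrow> bool" where
  "c_closed c G \<longleftrightarrow>
     (\<forall>u\<in>verts G. \<forall>v\<in>verts G. u \<noteq> v \<and> \<not> adjacent G u v \<longrightarrow>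
        card (neighbors G u \<inter> neighbors G v) \<le> c - 1)"

definition delete_verts :: "'a graph \<Rightarrow> 'a set \<Rightarrow> 'a graph" where
  "delete_verts G S = (verts G - S, {e \<in> edges G. e \<inter> S = {}})"

definition c_closed_vertex_deletion :: "nat \<Rightarrow> 'a graph \<times> nat \<Rightarrow> bool" where
  "c_closed_vertex_deletion c = (\<lambda>(G, k).
     \<exists>S \<subseteq> verts G. card S \<le> k \<and> c_closed c (delete_verts G S))"

section \<open>Machine model\<close>

text \<open>
  Random access machine with uniform cost, presented as a while language. The memory is a family
  of named unbounded arrays of natural numbers; a scalar variable is cell 0 of its array. The only
  arithmetic operations are addition and truncated subtraction: with multiplication, uniform cost
  on unbounded numbers would not be a realistic measure of time.
\<close>

type_synonym store = "string \<Rightarrow> nat \<Rightarrow> nat"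

datatype aexp = Const nat | Read string aexp | Add aexp aexp | Sub aexp aexp

datatype bexp = Less aexp aexp | Neg bexp | Conj bexp bexp

datatype com =
    Skip
  | Write string aexp aexp
  | Seq com com
  | Cond bexp com com
  | While bexp com

fun aval :: "aexp \<Rightarrow> store \<Rightarrow> nat" where
  "aval (Const n) s = n"
| "aval (Read x a) s = s x (aval a s)"
| "aval (Add a b) s = aval a s + aval b s"
| "aval (Sub a b) s = aval a s - aval b s"

fun bval :: "bexp \<Rightarrow> store \<Rightarrow> bool" where
  "bval (Less a b) s \<longleftrightarrow> aval a s < aval b s"
| "bval (Neg b) s \<longleftrightarrow> \<not> bval b s"
| "bval (Conj a b) s \<longleftrightarrow> bval a s \<and> bval b s"

text \<open>
  \<open>exec P s t s'\<close>: program \<open>P\<close> started in \<open>s\<close> halts in \<open>s'\<close> after \<open>t\<close> steps. One step is one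
  assignment or one test. Evaluating an expression takes a number of elementary operations that
  is fixed by the program text, so this agrees up to a constant factor depending only on the
  program with counting every elementary operation.
\<close>

inductive exec :: "com \<Rightarrow> store \<Rightarrow> nat \<Rightarrow> store \<Rightarrow> bool" where
  Skip: "exec Skip s 1 s"
| Write: "exec (Write x i a) s 1 (s(x := (s x)(aval i s := aval a s)))"
| Seq: "exec P s t s' \<Longrightarrow> exec Q s' t' s'' \<Longrightarrow> exec (Seq P Q) s (t + t') s''"
| CondTrue: "bval b s \<Longrightarrow> exec P s t s' \<Longrightarrow> exec (Cond b P Q) s (1 + t) s'"
| CondFalse: "\<not> bval b s \<Longrightarrow> exec Q s t s' \<Longrightarrow> exec (Cond b P Q) s (1 + t) s'"
| WhileFalse: "\<not> bval b s \<Longrightarrow> exec (While b P) s 1 s"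
| WhileTrue: "bval b s \<Longrightarrow> exec P s t s' \<Longrightarrow> exec (While b P) s' t' s'' \<Longrightarrow>
    exec (While b P) s (1 + t + t') s''"

inductive_cases exec_SkipE: "exec Skip s t s'"
inductive_cases exec_WriteE: "exec (Write x i a) s t s'"
inductive_cases exec_SeqE: "exec (Seq P Q) s t s'"
inductive_cases exec_CondE: "exec (Cond b P Q) s t s'"
inductive_cases exec_WhileE: "exec (While b P) s t s'"

lemma exec_deterministic:
  "exec P s t s' \<Longrightarrow> exec P s u s'' \<Longrightarrow> t = u \<and> s' = s''"
proof (induction arbitrary: u s'' rule: exec.induct)
  case (Skip s)
  then show ?case by (elim exec_SkipE) simp
next
  case (Write x i a s)
  then show ?case by (elim exec_WriteE) simp
next
  case (Seq P s t s1 Q t' s2)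
  from Seq.prems show ?case by (elim exec_SeqE) (auto dest!: Seq.IH)
next
  case (CondTrue b s P t s' Q)
  from CondTrue.prems CondTrue.hyps(1) show ?case
    by (elim exec_CondE) (auto dest!: CondTrue.IH)
next
  case (CondFalse b s Q t s' P)
  from CondFalse.prems CondFalse.hyps(1) show ?case
    by (elim exec_CondE) (auto dest!: CondFalse.IH)
next
  case (WhileFalse b s P)
  from WhileFalse.prems show ?case
    by (rule exec_WhileE) (use WhileFalse.hyps in auto)
next
  case (WhileTrue b s P t s1 t' s2)
  from WhileTrue.prems show ?case
  proof (rule exec_WhileE)
    fix v r w
    assume *: "u = Suc (v + w)" "exec P s v r" "exec (While b P) r w s''"
    from WhileTrue.IH(1)[OF *(2)] have "t = v" "s1 = r" by simp_all
    with WhileTrue.IH(2)[of w s''] * show ?thesis by simp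
  qed (use WhileTrue.hyps in auto)
qed

section \<open>Instances and kernels\<close>

text \<open>Machines receive graphs with vertex set \<open>{0, \<dots>, n - 1}\<close>.\<close>

definition valid_instance :: "nat graph \<times> nat \<Rightarrow> bool" where
  "valid_instance = (\<lambda>(G, k). simple_graph G \<and> verts G = {..<card (verts G)} \<and> 0 < k)"

text \<open>
  An instance is stored as the number of vertices in \<open>''n''\<close>, the parameter in \<open>''k''\<close> and the
  row-major adjacency matrix in \<open>''A''\<close>. On input, every other cell is 0; on output, the remaining
  cells are irrelevant.
\<close>

definition stores :: "store \<Rightarrow> nat graph \<times> nat \<Rightarrow> bool" where
  "stores s = (\<lambda>(G, k). let n = card (verts G) in
     s ''n'' 0 = n \<and> s ''k'' 0 = k \<and>
     (\<forall>i<n. \<forall>j<n. s ''A'' (i * n + j) = (if adjacent G i j then 1 else 0)))"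

definition instance_cells :: "nat \<Rightarrow> (string \<times> nat) set" where
  "instance_cells n = {(''n'', 0), (''k'', 0)} \<union> {''A''} \<times> {..<n * n}"

definition input_store :: "store \<Rightarrow> nat graph \<times> nat \<Rightarrow> bool" where
  "input_store s I \<longleftrightarrow> stores s I \<and>
     (\<forall>x i. (x, i) \<notin> instance_cells (card (verts (fst I))) \<longrightarrow> s x i = 0)"

definition computes_within ::
    "com \<Rightarrow> (nat graph \<times> nat \<Rightarrow> nat graph \<times> nat) \<Rightarrow> (nat graph \<times> nat \<Rightarrow> nat) \<Rightarrow> bool" where
  "computes_within P f T \<longleftrightarrow>
     (\<forall>I s. valid_instance I \<and> input_store s I \<longrightarrow>
        (\<exists>t s'. exec P s t s' \<and> stores s' (f I) \<and> t \<le> T I))"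

definition instance_size :: "'a graph \<times> nat \<Rightarrow> nat" where
  "instance_size = (\<lambda>(G, k). card (verts G) + card (edges G) + k)"

definition is_kernel ::
    "(nat graph \<times> nat \<Rightarrow> bool) \<Rightarrow> (nat graph \<times> nat \<Rightarrow> nat graph \<times> nat) \<Rightarrow> bool" where
  "is_kernel L f \<longleftrightarrow>
     (\<exists>g :: nat \<Rightarrow> nat. \<forall>G k. valid_instance (G, k) \<longrightarrow>
        valid_instance (f (G, k)) \<and> (L (f (G, k)) \<longleftrightarrow> L (G, k)) \<and>
        instance_size (f (G, k)) \<le> g k)"

end

theory Submission
  imports Defs
begin

text \<open>
  A graph is \<open>c\<close>-closed iff it has no obstruction: nonadjacent \<open>u \<noteq> v\<close> together with \<open>c\<close> common
  neighbors. Obstructions are written as tuples of length \<open>d = c + 2\<close>. They are scanned one by one,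
  and a tuple is kept unless for some set \<open>I\<close> of positions already \<open>cap (d - card I)\<close> kept tuples
  agree with it on \<open>I\<close>, where \<open>cap 0 = 1\<close> and \<open>cap (j + 1) = 1 + d k cap j\<close>. If such a set \<open>I\<close>
  exists, then every \<open>S\<close> with \<open>card S \<le> k\<close> that hits all kept tuples hits the given one on \<open>I\<close>:
  otherwise each of the \<open>cap (d - card I)\<close> tuples would be hit at one of at most \<open>d\<close> further
  positions by one of at most \<open>k\<close> vertices, and for each such choice there are at most
  \<open>cap (d - card I - 1)\<close> of them. So the kept tuples have the same hitting sets of size at most \<open>k\<close>
  as all obstructions, and the subgraph induced by their vertices is an equivalent instance with at
  most \<open>d cap d = O(k\<^bsup>c + 2\<^esup>)\<close> vertices.

  For a fixed pair \<open>u, v\<close> it suffices to look at \<open>k + c\<close> common neighbors, which gives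
  \<open>O(k\<^bsup>c\<^esup>)\<close> tuples. If \<open>cap d \<ge> n\<close> the instance is small already, and otherwise
  \<open>k\<^bsup>c\<^esup> \<le> n\<close>, so the scan takes time \<open>O(n\<^sup>3)\<close>.
\<close>

section \<open>Closedness relative to a vertex set\<close>

text \<open>The adjacency relation stays fixed and only the vertex set varies: deleting vertices
  shrinks \<open>V\<close>, and relabelling them takes an image.\<close>

definition closed_on :: "nat \<Rightarrow> 'a set \<Rightarrow> ('a \<Rightarrow> 'a \<Rightarrow> bool) \<Rightarrow> bool" where
  "closed_on c V adj \<longleftrightarrow> (\<forall>u\<in>V. \<forall>v\<in>V. u \<noteq> v \<and> \<not> adj u v \<longrightarrow>
     card {w \<in> V. adj u w \<and> adj v w} \<le> c - 1)"

lemma adjacent_commute: "adjacent G u v \<longleftrightarrow> adjacent G v u"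
  by (simp add: adjacent_def insert_commute)

lemma c_closed_delete_verts:
  "c_closed c (delete_verts G S) \<longleftrightarrow> closed_on c (verts G - S) (adjacent G)"
proof -
  have adj: "adjacent (delete_verts G S) u v \<longleftrightarrow> adjacent G u v"
    if "u \<in> verts G - S" "v \<in> verts G - S" for u v
    using that by (auto simp: adjacent_def delete_verts_def)
  have nbrs: "neighbors (delete_verts G S) u \<inter> neighbors (delete_verts G S) v =
      {w \<in> verts G - S. adjacent G u w \<and> adjacent G v w}"
    if "u \<in> verts G - S" "v \<in> verts G - S" for u v
    using that adj by (auto simp: neighbors_def delete_verts_def adjacent_commute)
  have vs: "verts (delete_verts G S) = verts G - S"
    by (simp add: delete_verts_def)
  show ?thesis
    unfolding c_closed_def closed_on_def vs
    by (intro ball_cong refl) (simp add: adj nbrs)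
qed

text \<open>In an induced subgraph nonadjacent pairs remain nonadjacent and common neighbors can
  only be lost.\<close>

lemma closed_on_mono:
  assumes "closed_on c V adj" "U \<subseteq> V" "finite V"
  shows "closed_on c U adj"
  unfolding closed_on_def
proof (intro ballI impI)
  fix u v assume uv: "u \<in> U" "v \<in> U" "u \<noteq> v \<and> \<not> adj u v"
  have "card {w \<in> U. adj u w \<and> adj v w} \<le> card {w \<in> V. adj u w \<and> adj v w}"
    using assms by (intro card_mono) auto
  also have "\<dots> \<le> c - 1"
    using assms uv by (auto simp: closed_on_def)
  finally show "card {w \<in> U. adj u w \<and> adj v w} \<le> c - 1" .
qed

lemma closed_on_inj_image:
  assumes inj: "inj_on h V"
    and adj: "\<And>i j. i \<in> V \<Longrightarrow> j \<in> V \<Longrightarrow> adj' i j \<longleftrightarrow> adj (h i) (h j)"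
  shows "closed_on c V adj' \<longleftrightarrow> closed_on c (h ` V) adj"
proof -
  have card: "card {w \<in> h ` V. adj (h i) w \<and> adj (h j) w} = card {w \<in> V. adj' i w \<and> adj' j w}"
    if "i \<in> V" "j \<in> V" for i j
  proof -
    have "{w \<in> h ` V. adj (h i) w \<and> adj (h j) w} = h ` {w \<in> V. adj' i w \<and> adj' j w}"
      using that adj by auto
    then show ?thesis
      using inj by (simp add: card_image inj_on_def)
  qed
  have eq: "h i = h j \<longleftrightarrow> i = j" if "i \<in> V" "j \<in> V" for i j
    using inj that by (auto simp: inj_on_def)
  show ?thesis
    unfolding closed_on_def ball_simps
    by (intro ball_cong refl) (simp add: eq adj card)
qed

section \<open>Selecting obstructions by counting\<close>

definition obstruction :: "nat \<Rightarrow> nat \<Rightarrow> (nat \<Rightarrow> nat \<Rightarrow> bool) \<Rightarrow> nat list \<Rightarrow> bool" where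
  "obstruction c n adj t \<longleftrightarrow> length t = c + 2 \<and> set t \<subseteq> {..<n} \<and> t ! 0 \<noteq> t ! 1 \<and>
     \<not> adj (t ! 0) (t ! 1) \<and> distinct (drop 2 t) \<and>
     (\<forall>w \<in> set (drop 2 t). adj (t ! 0) w \<and> adj (t ! 1) w)"

definition extensions :: "nat list set \<Rightarrow> nat set \<Rightarrow> nat list \<Rightarrow> nat list set" where
  "extensions K I t = {t' \<in> K. \<forall>j\<in>I. t' ! j = t ! j}"

fun cap :: "nat \<Rightarrow> nat \<Rightarrow> nat \<Rightarrow> nat" where
  "cap d k 0 = 1"
| "cap d k (Suc j) = 1 + d * k * cap d k j"

text \<open>Invariant of the scan. The case \<open>I = {}\<close> bounds the number of kept tuples;
  the other cases drive the pigeonhole argument in \<open>saturated_hit\<close>.\<close>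

definition capped :: "nat \<Rightarrow> nat \<Rightarrow> nat list set \<Rightarrow> bool" where
  "capped d k K \<longleftrightarrow> (\<forall>I t. I \<subseteq> {..<d} \<and> length t = d \<longrightarrow>
     card (extensions K I t) \<le> cap d k (d - card I))"

text \<open>For \<open>I = {..<d}\<close> the threshold is \<open>cap d k 0 = 1\<close>, so a kept
  tuple is itself saturated. The predicate thus means "kept or redundant".\<close>

definition saturated :: "nat \<Rightarrow> nat \<Rightarrow> nat list set \<Rightarrow> nat list \<Rightarrow> bool" where
  "saturated d k K t \<longleftrightarrow> (\<exists>I \<subseteq> {..<d}. cap d k (d - card I) \<le> card (extensions K I t))"

lemma finite_tuples: "finite {t. length t = d \<and> set t \<subseteq> {..<n::nat}}"
  using finite_lists_length_eq[of "{..<n}" d] by (simp add: conj_commute)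

lemma finite_obstructions:
  assumes "\<forall>t\<in>K. obstruction c n adj t"
  shows "finite K"
  by (rule finite_subset[OF _ finite_tuples[of "c + 2" n]])
    (use assms in \<open>auto simp: obstruction_def\<close>)

text \<open>Counters never decrease while tuples are added, so a verdict reached early in the scan
  remains valid at its end.\<close>

lemma saturated_mono:
  assumes "saturated d k K t" "K \<subseteq> K'" "finite K'"
  shows "saturated d k K' t"
proof -
  obtain I where I: "I \<subseteq> {..<d}" "cap d k (d - card I) \<le> card (extensions K I t)"
    using assms(1) by (auto simp: saturated_def)
  have "card (extensions K I t) \<le> card (extensions K' I t)"
    using assms by (intro card_mono) (auto simp: extensions_def)
  with I show ?thesis by (auto simp: saturated_def intro: order_trans)
qed

lemma saturated_hit:
  assumes fin: "finite K" and len: "\<forall>t'\<in>K. length t' = d" and cp: "capped d k K"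
    and hit: "\<forall>t'\<in>K. set t' \<inter> S \<noteq> {}" and S: "finite S" "card S \<le> k"
    and sat: "saturated d k K t" and t: "length t = d"
  shows "set t \<inter> S \<noteq> {}"
proof
  assume miss: "set t \<inter> S = {}"
  obtain I where I: "I \<subseteq> {..<d}" "cap d k (d - card I) \<le> card (extensions K I t)"
    using sat by (auto simp: saturated_def)
  have finI: "finite I" using I finite_subset by blast
  let ?R = "({..<d} - I) \<times> S"
  let ?F = "\<lambda>(i, x). extensions K (insert i I) (t[i := x])"
  \<comment> \<open>Each such tuple is hit somewhere, but not on \<open>I\<close>, where it agrees
    with the missed tuple \<open>t\<close>. So it is hit at a free position \<open>i\<close> by some
    \<open>x\<close> in \<open>S\<close> and extends \<open>t[i := x]\<close> on
    \<open>insert i I\<close>.\<close>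
  have sub: "extensions K I t \<subseteq> (\<Union>p\<in>?R. ?F p)"
  proof
    fix t' assume t': "t' \<in> extensions K I t"
    then have K: "t' \<in> K" and agree: "\<forall>j\<in>I. t' ! j = t ! j" by (auto simp: extensions_def)
    obtain i where i: "i < d" "t' ! i \<in> S"
      using hit len K by (metis disjoint_iff in_set_conv_nth)
    have "i \<notin> I"
      using agree i miss t by (metis disjoint_iff nth_mem)
    then have "t' \<in> ?F (i, t' ! i)"
      using K agree i t by (auto simp: extensions_def nth_list_update)
    then show "t' \<in> (\<Union>p\<in>?R. ?F p)" using i \<open>i \<notin> I\<close> by blast
  qed
  have "card (extensions K I t) \<le> card (\<Union>p\<in>?R. ?F p)"
    using sub S fin by (intro card_mono) (auto simp: extensions_def)
  also have "\<dots> \<le> (\<Sum>p\<in>?R. card (?F p))"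
    using S by (intro card_UN_le) auto
  \<comment> \<open>Fixing one more position passes to the next smaller cap, and
    \<open>capped\<close> already bounds that level, so one unfolding of the recursion is
    enough.\<close>
  also have "\<dots> \<le> (\<Sum>p\<in>?R. cap d k (d - Suc (card I)))"
  proof (rule sum_mono)
    fix p assume p: "p \<in> ?R"
    then have "card (?F p) \<le> cap d k (d - card (insert (fst p) I))"
      using cp I t by (auto simp: capped_def split: prod.splits)
    then show "card (?F p) \<le> cap d k (d - Suc (card I))"
      using p finI by auto
  qed
  also have "\<dots> = card ({..<d} - I) * card S * cap d k (d - Suc (card I))"
    by (simp add: card_cartesian_product)
  finally have le: "card (extensions K I t) \<le> card ({..<d} - I) * card S * cap d k (d - Suc (card I))" .
  show False
  \<comment> \<open>With all positions fixed the sum is empty while the cap is 1. Otherwise the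
    recursion of \<open>cap\<close> exceeds the pigeonhole bound by exactly 1.\<close>
  proof (cases "card I = d")
    case True
    then have "I = {..<d}" using I by (metis card_lessThan card_subset_eq finite_lessThan)
    then show False using I le by simp
  next
    case False
    then have "card I < d"
      using I by (metis card_lessThan card_mono finite_lessThan le_neq_implies_less)
    then have "cap d k (d - card I) = 1 + d * k * cap d k (d - Suc (card I))"
      by (metis Suc_diff_Suc cap.simps(2))
    moreover have "card ({..<d} - I) \<le> d"
      by (metis Diff_subset card_lessThan card_mono finite_lessThan)
    then have "card ({..<d} - I) * card S * cap d k (d - Suc (card I)) \<le> d * k * cap d k (d - Suc (card I))"
      using S by (intro mult_le_mono) auto
    ultimately show False using le I by linarith
  qed
qed

text \<open>Adding \<open>t\<close> raises only counters of partial tuples that agree with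
  \<open>t\<close>, each by at most 1, and as \<open>t\<close> is unsaturated these were strictly
  below their caps.\<close>

lemma capped_insert:
  assumes "capped d k K" "\<not> saturated d k K t" "finite K"
  shows "capped d k (insert t K)"
  unfolding capped_def
proof (intro allI impI)
  fix I and t' :: "nat list" assume I: "I \<subseteq> {..<d} \<and> length t' = d"
  show "card (extensions (insert t K) I t') \<le> cap d k (d - card I)"
  proof (cases "\<forall>j\<in>I. t ! j = t' ! j")
    case True
    then have "extensions (insert t K) I t' = insert t (extensions K I t)"
      by (auto simp: extensions_def)
    moreover have "card (insert t (extensions K I t)) \<le> Suc (card (extensions K I t))"
      by (rule card_insert_le_m1) auto
    moreover have "card (extensions K I t) < cap d k (d - card I)"
      using assms(2) I by (auto simp: saturated_def not_le)
    ultimately show ?thesis by simp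
  next
    case False
    then have "extensions (insert t K) I t' = extensions K I t'"
      by (auto simp: extensions_def)
    then show ?thesis using assms(1) I by (simp add: capped_def)
  qed
qed

text \<open>The constant depends on \<open>d\<close> and \<open>j\<close> only. As
  \<open>k \<ge> 1\<close>, the summand 1 of the recursion is absorbed into
  \<open>k ^ Suc j\<close>. With \<open>j = d = c + 2\<close> this gives the exponent of the kernel
  size.\<close>

lemma cap_bound: "\<exists>C. \<forall>k\<ge>1. cap d k j \<le> C * k ^ j"
proof (induction j)
  case 0
  show ?case by (auto intro!: exI[of _ 1])
next
  case (Suc j)
  then obtain C where C: "\<forall>k\<ge>1. cap d k j \<le> C * k ^ j" by auto
  show ?case
  proof (intro exI allI impI)
    fix k :: nat assume k: "k \<ge> 1"
    have "cap d k (Suc j) \<le> k ^ Suc j + d * k * (C * k ^ j)"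
      using C k by (simp only: cap.simps) (intro add_mono mult_left_mono, auto)
    then show "cap d k (Suc j) \<le> (1 + d * C) * k ^ Suc j"
      by (simp add: algebra_simps)
  qed
qed

text \<open>Serves the running time: if \<open>cap d k d < n\<close>, then powers of
  \<open>k\<close> up to \<open>k ^ d\<close> are below \<open>n\<close>.\<close>

lemma power_le_cap: "d \<ge> 1 \<Longrightarrow> k ^ j \<le> cap d k j"
proof (induction j)
  case (Suc j)
  have "k * k ^ j \<le> d * k * cap d k j"
    using Suc by (intro mult_le_mono) auto
  then show ?case by (simp only: power_Suc cap.simps)
qed simp

text \<open>The guarantee left behind by the scan of one pair. Looking at \<open>k + c\<close>
  common neighbors is enough, because \<open>c\<close> of them survive the deletion of any
  \<open>k\<close> vertices. One ordering \<open>ws\<close> of each \<open>C\<close> is enough,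
  because being hit depends only on the set of entries.\<close>

definition covers :: "nat \<Rightarrow> nat \<Rightarrow> nat \<Rightarrow> (nat \<Rightarrow> nat \<Rightarrow> bool) \<Rightarrow> nat list set \<Rightarrow> nat \<Rightarrow> nat \<Rightarrow> bool" where
  "covers c k n adj K u v \<longleftrightarrow> (u \<noteq> v \<and> \<not> adj u v \<longrightarrow>
     (\<exists>L. L \<subseteq> {w. w < n \<and> adj u w \<and> adj v w} \<and>
       (L = {w. w < n \<and> adj u w \<and> adj v w} \<or> k + c \<le> card L) \<and>
       (\<forall>C \<subseteq> L. card C = c \<longrightarrow> (\<exists>ws. set ws = C \<and> length ws = c \<and>
          saturated (c + 2) k K (u # v # ws)))))"

lemma covers_mono:
  assumes "covers c k n adj K u v" "K \<subseteq> K'" "finite K'"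
  shows "covers c k n adj K' u v"
  unfolding covers_def
proof
  assume uv: "u \<noteq> v \<and> \<not> adj u v"
  then obtain L where L: "L \<subseteq> {w. w < n \<and> adj u w \<and> adj v w}"
    "L = {w. w < n \<and> adj u w \<and> adj v w} \<or> k + c \<le> card L"
    "\<forall>C \<subseteq> L. card C = c \<longrightarrow> (\<exists>ws. set ws = C \<and> length ws = c \<and>
       saturated (c + 2) k K (u # v # ws))"
    using mp[OF assms(1)[unfolded covers_def] uv] by (elim exE conjE)
  then have "\<forall>C \<subseteq> L. card C = c \<longrightarrow> (\<exists>ws. set ws = C \<and> length ws = c \<and>
       saturated (c + 2) k K' (u # v # ws))"
    by (metis saturated_mono[OF _ assms(2,3)])
  with L show "\<exists>L. L \<subseteq> {w. w < n \<and> adj u w \<and> adj v w} \<and>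
       (L = {w. w < n \<and> adj u w \<and> adj v w} \<or> k + c \<le> card L) \<and>
       (\<forall>C \<subseteq> L. card C = c \<longrightarrow> (\<exists>ws. set ws = C \<and> length ws = c \<and>
          saturated (c + 2) k K' (u # v # ws)))"
    by (intro exI[of _ L] conjI)
qed

text \<open>If \<open>u\<close>, \<open>v\<close> violated closedness outside \<open>S\<close>, then
  \<open>c\<close> of the examined common neighbors would avoid \<open>S\<close>. Their tuple is
  saturated, hence hit by \<open>saturated_hit\<close>, although none of its entries lies in
  \<open>S\<close>.\<close>

lemma hitting_closed:
  assumes obs: "\<forall>t\<in>K. obstruction c n adj t" and cp: "capped (c + 2) k K"
    and cov: "\<forall>u<n. \<forall>v<n. covers c k n adj K u v"
    and S: "finite S" "card S \<le> k" and hit: "\<forall>t\<in>K. set t \<inter> S \<noteq> {}" and c: "c \<ge> 1"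
  shows "closed_on c ({..<n} - S) adj"
  unfolding closed_on_def
proof (intro ballI impI, rule ccontr)
  fix u v
  assume uv: "u \<in> {..<n} - S" "v \<in> {..<n} - S" "u \<noteq> v \<and> \<not> adj u v"
    and "\<not> card {w \<in> {..<n} - S. adj u w \<and> adj v w} \<le> c - 1"
  then have big: "c \<le> card {w \<in> {..<n} - S. adj u w \<and> adj v w}" by linarith
  let ?N = "{w. w < n \<and> adj u w \<and> adj v w}"
  have covuv: "covers c k n adj K u v" using cov uv by simp
  obtain L where L: "L \<subseteq> ?N" "L = ?N \<or> k + c \<le> card L"
    "\<forall>C \<subseteq> L. card C = c \<longrightarrow> (\<exists>ws. set ws = C \<and> length ws = c \<and> saturated (c + 2) k K (u # v # ws))"
    using mp[OF covuv[unfolded covers_def] uv(3)] by (elim exE conjE)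
  have finL: "finite L" by (rule finite_subset[OF L(1)]) simp
  \<comment> \<open>If \<open>L\<close> is complete, this is the assumed violation; if it was cut
    off, at most \<open>k\<close> of its \<open>k + c\<close> elements lie in
    \<open>S\<close>.\<close>
  have "c \<le> card (L - S)"
  proof (cases "L = ?N")
    case True
    then have "L - S = {w \<in> {..<n} - S. adj u w \<and> adj v w}" by auto
    then show ?thesis using big by simp
  next
    case False
    then show ?thesis using L(2) S diff_card_le_card_Diff[OF S(1), of L] by linarith
  qed
  then obtain C where C: "C \<subseteq> L - S" "card C = c"
    by (meson obtain_subset_with_card_n)
  have "C \<subseteq> L" using C(1) by blast
  from L(3)[rule_format, OF this C(2)]
  obtain ws where ws: "set ws = C" "length ws = c" "saturated (c + 2) k K (u # v # ws)"
    by (elim exE conjE)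
  have "set (u # v # ws) \<inter> S \<noteq> {}"
    by (rule saturated_hit[OF finite_obstructions[OF obs] _ cp hit S ws(3)])
      (use obs ws in \<open>auto simp: obstruction_def\<close>)
  then show False using uv C ws(1) by auto
qed

text \<open>An unhit obstruction inside \<open>W\<close> would survive in \<open>W - S\<close> with
  \<open>c\<close> common neighbors; \<open>c \<ge> 1\<close> makes \<open>c - 1\<close> smaller
  than \<open>c\<close> despite truncated subtraction.\<close>

lemma closed_hits:
  assumes t: "obstruction c n adj t" "set t \<subseteq> W" and W: "finite W"
    and cl: "closed_on c (W - S) adj" and c: "c \<ge> 1"
  shows "set t \<inter> S \<noteq> {}"
proof
  assume miss: "set t \<inter> S = {}"
  have len: "length t = c + 2" using t by (simp add: obstruction_def)
  have ends: "t ! 0 \<in> set t" "t ! 1 \<in> set t" using len by simp_all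
  have "set (drop 2 t) \<subseteq> {w \<in> W - S. adj (t ! 0) w \<and> adj (t ! 1) w}"
    using t miss set_drop_subset[of 2 t] by (auto simp: obstruction_def)
  then have "card (set (drop 2 t)) \<le> card {w \<in> W - S. adj (t ! 0) w \<and> adj (t ! 1) w}"
    using W by (intro card_mono) auto
  moreover have "card (set (drop 2 t)) = c"
    using t len by (simp add: obstruction_def distinct_card)
  moreover have "card {w \<in> W - S. adj (t ! 0) w \<and> adj (t ! 1) w} \<le> c - 1"
    using cl ends miss t unfolding closed_on_def obstruction_def by blast
  ultimately show False using c by linarith
qed

section \<open>The relabelled induced subgraph as an equivalent instance\<close>

definition induced :: "nat graph \<Rightarrow> nat list \<Rightarrow> nat graph" where
  "induced G l = ({..<length l},
     {{i, j} | i j. i < length l \<and> j < length l \<and> i \<noteq> j \<and> adjacent G (l ! i) (l ! j)})"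

lemma adjacent_irrefl: "simple_graph G \<Longrightarrow> \<not> adjacent G u u"
  by (auto simp: simple_graph_def adjacent_def)

lemma adjacent_induced:
  assumes "simple_graph G" "i < length l" "j < length l"
  shows "adjacent (induced G l) i j \<longleftrightarrow> adjacent G (l ! i) (l ! j)"
proof -
  have "i \<noteq> j" if "adjacent G (l ! i) (l ! j)"
    using that adjacent_irrefl[OF assms(1)] by metis
  then have "adjacent G (l ! i) (l ! j) \<longleftrightarrow> {i, j} \<in> edges (induced G l)"
    using assms(2,3) adjacent_commute[of G] unfolding induced_def
    by (fastforce simp: doubleton_eq_iff)
  then show ?thesis by (simp add: adjacent_def)
qed

lemma simple_graph_induced: "simple_graph (induced G l)"
  by (auto simp: simple_graph_def induced_def)

text \<open>Kernel vertex \<open>i\<close> stands for \<open>l ! i\<close>. A kernel solution,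
  carried over to \<open>G\<close>, hits all kept tuples since these live on \<open>set l\<close>,
  so \<open>hitting_closed\<close> applies. Conversely, closedness is inherited by the subgraph
  induced on \<open>set l\<close>.\<close>

lemma induced_equivalent:
  assumes G: "simple_graph G" "verts G = {..<n}"
    and obs: "\<forall>t\<in>K. obstruction c n (adjacent G) t" and cp: "capped (c + 2) k K"
    and cov: "\<forall>u<n. \<forall>v<n. covers c k n (adjacent G) K u v" and c: "c \<ge> 1"
    and l: "distinct l" "set l = \<Union> (set ` K)"
  shows "c_closed_vertex_deletion c (induced G l, k) \<longleftrightarrow> c_closed_vertex_deletion c (G, k)"
proof -
  let ?h = "\<lambda>i. l ! i"
  let ?m = "length l"
  have inj: "inj_on ?h {..<?m}"
    using l(1) by (auto simp: inj_on_def nth_eq_iff_index_eq)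
  have img: "?h ` {..<?m} = set l"
    by (auto simp: in_set_conv_nth)
  have ln: "set l \<subseteq> {..<n}"
    using l(2) obs unfolding obstruction_def by blast
  have closed: "c_closed c (delete_verts (induced G l) S) \<longleftrightarrow> closed_on c (set l - ?h ` S) (adjacent G)"
    if "S \<subseteq> {..<?m}" for S
  proof -
    have "closed_on c ({..<?m} - S) (adjacent (induced G l)) \<longleftrightarrow>
        closed_on c (?h ` ({..<?m} - S)) (adjacent G)"
      by (rule closed_on_inj_image) (use inj G in \<open>auto simp: adjacent_induced intro: inj_on_subset\<close>)
    also have "?h ` ({..<?m} - S) = set l - ?h ` S"
      using inj_on_image_set_diff[OF inj _ that] img by simp
    finally show ?thesis by (simp add: c_closed_delete_verts) (simp add: induced_def)
  qed
  show ?thesis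
  proof
    assume "c_closed_vertex_deletion c (induced G l, k)"
    then obtain S where S: "S \<subseteq> {..<?m}" "card S \<le> k" "c_closed c (delete_verts (induced G l) S)"
      by (auto simp: c_closed_vertex_deletion_def induced_def)
    have fin: "finite S" using S(1) finite_subset by blast
    have "closed_on c ({..<n} - ?h ` S) (adjacent G)"
    proof (rule hitting_closed[OF obs cp cov])
      show "\<forall>t\<in>K. set t \<inter> ?h ` S \<noteq> {}"
        using closed_hits[OF _ _ _ _ c, of n "adjacent G" _ "set l" "?h ` S"] obs l(2) closed S by blast
    qed (use fin c S card_image_le[OF fin, of ?h] in auto)
    moreover have "?h ` S \<subseteq> {..<n}" using S(1) img ln by blast
    moreover have "card (?h ` S) \<le> k" using S card_image_le[OF fin, of ?h] by linarith
    ultimately show "c_closed_vertex_deletion c (G, k)"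
      unfolding c_closed_vertex_deletion_def by (auto simp: c_closed_delete_verts G(2))
  next
    assume "c_closed_vertex_deletion c (G, k)"
    then obtain S where S: "S \<subseteq> {..<n}" "card S \<le> k" "closed_on c ({..<n} - S) (adjacent G)"
      by (auto simp: c_closed_vertex_deletion_def c_closed_delete_verts G(2))
    \<comment> \<open>A solution of \<open>G\<close> may use vertices outside \<open>set l\<close>;
      only its part inside is pulled back, so the size does not grow.\<close>
    let ?S = "{i \<in> {..<?m}. ?h i \<in> S}"
    have hS: "?h ` ?S = set l \<inter> S" using img by auto
    have "card ?S = card (?h ` ?S)"
      using inj by (intro card_image[symmetric]) (auto simp: inj_on_def)
    also have "\<dots> \<le> card S"
      using S(1) finite_subset hS by (intro card_mono) auto
    finally have "card ?S \<le> k" using S(2) by linarith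
    moreover have "closed_on c (set l - ?h ` ?S) (adjacent G)"
      by (rule closed_on_mono[OF S(3)]) (use ln hS in auto)
    then have "c_closed c (delete_verts (induced G l) ?S)"
      using closed[of ?S] by auto
    ultimately show "c_closed_vertex_deletion c (induced G l, k)"
      unfolding c_closed_vertex_deletion_def by (auto simp: induced_def intro!: exI[of _ ?S])
  qed
qed

lemma card_vertices_le:
  assumes obs: "\<forall>t\<in>K. obstruction c n adj t" and cp: "capped (c + 2) k K"
  shows "card (\<Union> (set ` K)) \<le> (c + 2) * cap (c + 2) k (c + 2)"
proof -
  \<comment> \<open>With no prescribed position every kept tuple counts as an extension; the list
    only has to have length \<open>c + 2\<close>.\<close>
  have "extensions K {} (replicate (c + 2) 0) = K" by (auto simp: extensions_def)
  then have K: "card K \<le> cap (c + 2) k (c + 2)"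
    using cp unfolding capped_def
    by (metis card.empty diff_zero empty_subsetI length_replicate)
  have "card (\<Union> (set ` K)) \<le> (\<Sum>t\<in>K. card (set t))"
    using finite_obstructions[OF obs] by (rule card_UN_le)
  also have "\<dots> \<le> (\<Sum>t\<in>K. c + 2)"
    using obs by (intro sum_mono) (metis card_length obstruction_def)
  also have "\<dots> \<le> (c + 2) * cap (c + 2) k (c + 2)"
    using mult_le_mono2[OF K, of "c + 2"] by (simp only: sum_constant mult.commute of_nat_id)
  finally show ?thesis .
qed

section \<open>Timed total correctness\<close>

text \<open>A total-correctness triple with a time budget. The budget is an upper bound, so it can
  be relaxed freely.\<close>

definition runs :: "com \<Rightarrow> store \<Rightarrow> nat \<Rightarrow> (store \<Rightarrow> bool) \<Rightarrow> bool" where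
  "runs P s T Q \<longleftrightarrow> (\<exists>t s'. exec P s t s' \<and> t \<le> T \<and> Q s')"

lemma runs_mono:
  assumes "runs P s T Q" "T \<le> T'" "\<And>s'. Q s' \<Longrightarrow> Q' s'"
  shows "runs P s T' Q'"
  using assms unfolding runs_def by (meson order_trans)

lemma runs_Skip [simp]: "runs Skip s T Q \<longleftrightarrow> 1 \<le> T \<and> Q s"
  unfolding runs_def by (metis exec.Skip exec_SkipE)

lemma runs_Write [simp]:
  "runs (Write x i a) s T Q \<longleftrightarrow> 1 \<le> T \<and> Q (s(x := (s x)(aval i s := aval a s)))"
  unfolding runs_def by (metis exec.Write exec_WriteE)

lemma runs_Cond [simp]:
  "runs (Cond b P R) s T Q \<longleftrightarrow>
     1 \<le> T \<and> (if bval b s then runs P s (T - 1) Q else runs R s (T - 1) Q)"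
proof
  assume "runs (Cond b P R) s T Q"
  then obtain t s' where "exec (Cond b P R) s t s'" "t \<le> T" "Q s'" unfolding runs_def by blast
  then show "1 \<le> T \<and> (if bval b s then runs P s (T - 1) Q else runs R s (T - 1) Q)"
    by (elim exec_CondE) (force simp: runs_def)+
next
  assume "1 \<le> T \<and> (if bval b s then runs P s (T - 1) Q else runs R s (T - 1) Q)"
  then show "runs (Cond b P R) s T Q"
    unfolding runs_def
    by (smt (verit, best) CondFalse CondTrue add.commute le_diff_conv2)
qed

lemma runs_Seq:
  assumes "runs P s T\<^sub>1 (\<lambda>s'. runs R s' T\<^sub>2 Q)" "T\<^sub>1 + T\<^sub>2 \<le> T"
  shows "runs (Seq P R) s T Q"
proof -
  obtain t s' where "exec P s t s'" "t \<le> T\<^sub>1" "runs R s' T\<^sub>2 Q"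
    using assms(1) unfolding runs_def by blast
  moreover from this obtain t' s'' where "exec R s' t' s''" "t' \<le> T\<^sub>2" "Q s''"
    unfolding runs_def by blast
  ultimately show ?thesis
    using assms(2) exec.Seq unfolding runs_def by (meson add_mono order_trans)
qed

text \<open>As an equivalence, this lets the simplifier execute straight-line code symbolically,
  charging 1 per assignment.\<close>

lemma runs_Write_Seq [simp]:
  "runs (Seq (Write x i a) R) s T Q \<longleftrightarrow>
     1 \<le> T \<and> runs R (s(x := (s x)(aval i s := aval a s))) (T - 1) Q"
proof
  assume "runs (Seq (Write x i a) R) s T Q"
  then show "1 \<le> T \<and> runs R (s(x := (s x)(aval i s := aval a s))) (T - 1) Q"
    unfolding runs_def by (force elim!: exec_SeqE exec_WriteE)
next
  assume "1 \<le> T \<and> runs R (s(x := (s x)(aval i s := aval a s))) (T - 1) Q"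
  then show "runs (Seq (Write x i a) R) s T Q"
    by (intro runs_Seq[where T\<^sub>1 = 1 and T\<^sub>2 = "T - 1"]) simp_all
qed

abbreviation var :: "string \<Rightarrow> aexp" where
  "var x \<equiv> Read x (Const 0)"

text \<open>The counter may be any cell of an array. Nested loops can thus share the array
  \<open>''i''\<close>, and entries of the tuple array \<open>''x''\<close> can themselves be
  counters.\<close>

definition for_loop :: "string \<Rightarrow> nat \<Rightarrow> aexp \<Rightarrow> aexp \<Rightarrow> com \<Rightarrow> com" where
  "for_loop x j a b P = Seq (Write x (Const j) a)
     (While (Less (Read x (Const j)) b)
       (Seq P (Write x (Const j) (Add (Read x (Const j)) (Const 1)))))"

text \<open>The invariant is indexed by the counter and holds at the loop head, so the step must
  restore it after the increment. Each iteration costs the body plus 2, for the test and the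
  increment.\<close>

lemma runs_while:
  assumes "Inv i s" "s x j = i" "i \<le> N"
    and step: "\<And>i s. i < N \<Longrightarrow> Inv i s \<Longrightarrow> s x j = i \<Longrightarrow>
      runs P s T (\<lambda>s'. s' x j = i \<and> Inv (Suc i) (s'(x := (s' x)(j := Suc i))))"
    and bound: "\<And>i s. Inv i s \<Longrightarrow> aval b s = N"
    and post: "\<And>s. Inv N s \<Longrightarrow> Q s"
  shows "runs (While (Less (Read x (Const j)) b)
      (Seq P (Write x (Const j) (Add (Read x (Const j)) (Const 1))))) s ((N - i) * (T + 2) + 1) Q"
  using assms(1-3)
proof (induction "N - i" arbitrary: i s)
  case 0
  then have "\<not> bval (Less (Read x (Const j)) b) s" "Q s" using bound[of i s] post by auto
  then show ?case using exec.WhileFalse unfolding runs_def by (metis le_add2)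
next
  case (Suc m)
  then have i: "i < N" by simp
  then have b: "bval (Less (Read x (Const j)) b) s" using bound[of i s] Suc by simp
  obtain t s' where s': "exec P s t s'" "t \<le> T" "s' x j = i" "Inv (Suc i) (s'(x := (s' x)(j := Suc i)))"
    using step[OF i Suc.prems(1,2)] unfolding runs_def by blast
  let ?s = "s'(x := (s' x)(j := Suc i))"
  let ?W = "Write x (Const j) (Add (Read x (Const j)) (Const 1))"
  have "exec ?W s' 1 ?s"
    using exec.Write[of x "Const j" "Add (Read x (Const j)) (Const 1)" s'] s'(3) by simp
  then have body: "exec (Seq P ?W) s (t + 1) ?s" by (rule exec.Seq[OF s'(1)])
  have m: "m = N - Suc i" "Suc i \<le> N" using Suc i by auto
  obtain t' s'' where t': "exec (While (Less (Read x (Const j)) b) (Seq P ?W)) ?s t' s''"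
    "t' \<le> (N - Suc i) * (T + 2) + 1" "Q s''"
    using Suc.hyps(1)[OF m(1) s'(4) _ m(2)] unfolding runs_def by auto
  have "N - i = Suc (N - Suc i)" using i by simp
  then have "1 + (t + 1) + t' \<le> (N - i) * (T + 2) + 1"
    using t'(2) s'(2) by simp
  then show ?case
    using exec.WhileTrue[OF b body t'(1)] t'(3) unfolding runs_def by blast
qed

text \<open>The final 2 in the budget pays for the initial assignment and the failing last test;
  starting above 0 only saves iterations.\<close>

lemma runs_for_loop:
  assumes init: "Inv (aval a s) (s(x := (s x)(j := aval a s)))" "aval a s \<le> N"
    and step: "\<And>i s. i < N \<Longrightarrow> Inv i s \<Longrightarrow> s x j = i \<Longrightarrow>
      runs P s T (\<lambda>s'. s' x j = i \<and> Inv (Suc i) (s'(x := (s' x)(j := Suc i))))"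
    and bound: "\<And>i s. Inv i s \<Longrightarrow> aval b s = N"
    and post: "\<And>s. Inv N s \<Longrightarrow> Q s"
    and time: "N * (T + 2) + 2 \<le> T'"
  shows "runs (for_loop x j a b P) s T' Q"
proof -
  let ?s = "s(x := (s x)(j := aval a s))"
  have "runs (While (Less (Read x (Const j)) b)
      (Seq P (Write x (Const j) (Add (Read x (Const j)) (Const 1))))) ?s
      ((N - aval a s) * (T + 2) + 1) Q"
    by (rule runs_while[where Inv = Inv]) (use assms in auto)
  moreover have "(N - aval a s) * (T + 2) \<le> N * (T + 2)"
    by (intro mult_le_mono1) simp
  ultimately have "runs (While (Less (Read x (Const j)) b)
      (Seq P (Write x (Const j) (Add (Read x (Const j)) (Const 1))))) ?s (T' - 1) Q"
    using time by (auto elim!: runs_mono)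
  then show ?thesis using time by (simp add: for_loop_def)
qed

text \<open>Repetition in the program text, for indices that select an array name or a constant and
  so cannot be computed at run time.\<close>

definition seqs :: "com list \<Rightarrow> com" where
  "seqs Ps = foldr Seq Ps Skip"

lemma seqs_simps [simp]: "seqs [] = Skip" "seqs (P # Ps) = Seq P (seqs Ps)"
  by (simp_all add: seqs_def)

lemma runs_seqs:
  assumes "Inv 0 s"
    and step: "\<And>j s. j < m \<Longrightarrow> Inv j s \<Longrightarrow> runs (P j) s T (Inv (Suc j))"
    and post: "\<And>s. Inv m s \<Longrightarrow> Q s"
    and time: "m * T + 1 \<le> T'"
  shows "runs (seqs (map P [0..<m])) s T' Q"
proof -
  have "runs (seqs (map P [j..<m])) s ((m - j) * T + 1) Q" if "Inv j s" "j \<le> m" for j s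
    using that
  proof (induction "m - j" arbitrary: j s)
    case 0
    then show ?case using post by simp
  next
    case (Suc i)
    then have j: "j < m" by simp
    have "runs (Seq (P j) (seqs (map P [Suc j..<m]))) s ((m - j) * T + 1) Q"
    proof (rule runs_Seq)
      show "runs (P j) s T (\<lambda>s'. runs (seqs (map P [Suc j..<m])) s' ((m - Suc j) * T + 1) Q)"
        by (rule runs_mono[OF step[OF j Suc.prems(1)] order_refl])
          (use Suc j in auto)
      have "m - j = Suc (m - Suc j)" using j by simp
      then show "T + ((m - Suc j) * T + 1) \<le> (m - j) * T + 1" by simp
    qed
    then show ?case using j by (simp add: upt_conv_Cons)
  qed
  from this[of 0 s] assms show ?thesis by (auto elim: runs_mono)
qed

section \<open>Counters of partial tuples\<close>

text \<open>Digits in base \<open>Suc n\<close>. The shift by \<open>Suc\<close> distinguishes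
  vertex 0 from a free position.\<close>

definition code :: "nat \<Rightarrow> nat set \<Rightarrow> nat list \<Rightarrow> nat" where
  "code n I t = (\<Sum>j\<in>I. Suc (t ! j) * Suc n ^ j)"

lemma digits_bound:
  assumes "\<And>j. j < d \<Longrightarrow> p j \<le> (n::nat)"
  shows "(\<Sum>j<d. p j * Suc n ^ j) < Suc n ^ d"
  using assms
proof (induction d)
  case (Suc d)
  have "(\<Sum>j<d. p j * Suc n ^ j) < Suc n ^ d" using Suc by simp
  moreover have "p d * Suc n ^ d \<le> n * Suc n ^ d" using Suc by (intro mult_le_mono1) simp
  ultimately have "(\<Sum>j<d. p j * Suc n ^ j) + p d * Suc n ^ d < Suc n ^ d + n * Suc n ^ d"
    by (rule add_less_le_mono)
  then show ?case by simp
qed simp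

lemma digits_inject:
  assumes "\<And>j. j < d \<Longrightarrow> p j \<le> (n::nat)" "\<And>j. j < d \<Longrightarrow> q j \<le> n"
    "(\<Sum>j<d. p j * Suc n ^ j) = (\<Sum>j<d. q j * Suc n ^ j)" "j < d"
  shows "p j = q j"
  using assms
proof (induction d arbitrary: j)
  case (Suc d)
  let ?p = "\<Sum>j<d. p j * Suc n ^ j" and ?q = "\<Sum>j<d. q j * Suc n ^ j"
  have lt: "?p < Suc n ^ d" "?q < Suc n ^ d" using Suc.prems by (simp_all add: digits_bound)
  have eq: "?p + p d * Suc n ^ d = ?q + q d * Suc n ^ d" using Suc.prems(3) by simp
  \<comment> \<open>Reduction modulo \<open>Suc n ^ d\<close> removes the leading digit, and by
    \<open>digits_bound\<close> the rest is already reduced.\<close>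
  have "(?p + p d * Suc n ^ d) mod Suc n ^ d = (?q + q d * Suc n ^ d) mod Suc n ^ d"
    by (simp only: eq)
  then have "?p = ?q" using lt by (simp only: mod_mult_self1 mod_less)
  with eq have "p d = q d" by simp
  moreover have "p j = q j" if "j < d"
    by (rule Suc.IH[OF _ _ \<open>?p = ?q\<close> that]) (simp_all add: Suc.prems(1,2))
  ultimately show ?case using Suc.prems(4) less_Suc_eq by blast
qed simp

lemma code_digits:
  assumes "I \<subseteq> {..<d}"
  shows "code n I t = (\<Sum>j<d. (if j \<in> I then Suc (t ! j) else 0) * Suc n ^ j)"
proof -
  have "code n I t = (\<Sum>j\<in>I. (if j \<in> I then Suc (t ! j) else 0) * Suc n ^ j)"
    by (simp add: code_def)
  also have "\<dots> = (\<Sum>j<d. (if j \<in> I then Suc (t ! j) else 0) * Suc n ^ j)"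
    using assms by (intro sum.mono_neutral_left) auto
  finally show ?thesis .
qed

text \<open>By uniqueness of digits there are no collisions, even between different position sets,
  so a single array can hold all counters.\<close>

lemma code_eq_iff:
  assumes I: "I \<subseteq> {..<d}" "I' \<subseteq> {..<d}"
    and t: "length t = d" "set t \<subseteq> {..<n}" "length t' = d" "set t' \<subseteq> {..<n}"
  shows "code n I t = code n I' t' \<longleftrightarrow> I = I' \<and> (\<forall>j\<in>I. t ! j = t' ! j)"
proof
  assume eq: "code n I t = code n I' t'"
  have nth: "t ! j < n" "t' ! j < n" if "j < d" for j
    using subsetD[OF t(2) nth_mem] subsetD[OF t(4) nth_mem] that by (simp_all add: t(1,3))
  have dig: "(if j \<in> I then Suc (t ! j) else 0) = (if j \<in> I' then Suc (t' ! j) else 0)" if "j < d" for j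
    by (rule digits_inject[OF _ _ eq[unfolded code_digits[OF I(1)] code_digits[OF I(2)]] that])
      (simp_all add: Suc_le_eq nth)
  have mem: "j \<in> I \<longleftrightarrow> j \<in> I'" if "j < d" for j
    using dig[OF that] by (auto split: if_splits)
  then have "I = I'" using I by blast
  moreover have "t ! j = t' ! j" if "j \<in> I" for j
    using dig[of j] mem[of j] that I by auto
  ultimately show "I = I' \<and> (\<forall>j\<in>I. t ! j = t' ! j)" by blast
next
  assume "I = I' \<and> (\<forall>j\<in>I. t ! j = t' ! j)"
  then show "code n I t = code n I' t'" by (auto simp: code_def)
qed

text \<open>
  Array \<open>table j\<close> holds the multiples \<open>Suc v * Suc n ^ j\<close>, because the machine cannot multiply. The
  counter of the tuples with prescribed entries at the positions in \<open>I\<close> is cell \<open>code n I t\<close> of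
  array \<open>''N''\<close>: digit 0 in base \<open>Suc n\<close> marks a free position.
\<close>

definition table :: "nat \<Rightarrow> string" where
  "table j = replicate (Suc j) (CHR ''t'')"

lemma table_inject [simp]: "table i = table j \<longleftrightarrow> i = j"
  by (simp add: table_def del: replicate.simps)

lemma table_neq [simp]:
  assumes "ch \<noteq> CHR ''t''"
  shows "table j \<noteq> ch # x" "ch # x \<noteq> table j"
  using assms by (auto simp: table_def)

section \<open>Representation of the kept tuples in the store\<close>

definition holds_input :: "nat \<Rightarrow> nat \<Rightarrow> (nat \<Rightarrow> nat \<Rightarrow> bool) \<Rightarrow> store \<Rightarrow> bool" where
  "holds_input n k adj s \<longleftrightarrow> s ''n'' 0 = n \<and> s ''k'' 0 = k \<and>
     (\<forall>i<n. \<forall>j<n. s ''A'' (i * n + j) = of_bool (adj i j))"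

text \<open>Precomputed products replacing multiplication: row offsets of the matrix, caps, and the
  summands of \<open>code\<close>.\<close>

definition holds_tables :: "nat \<Rightarrow> nat \<Rightarrow> nat \<Rightarrow> store \<Rightarrow> bool" where
  "holds_tables d n k s \<longleftrightarrow> (\<forall>i<n. s ''r'' i = i * n) \<and> (\<forall>j\<le>d. s ''c'' j = cap d k j) \<and>
     (\<forall>j<d. \<forall>v<n. s (table j) v = Suc v * Suc n ^ j)"

definition holds_counts :: "nat \<Rightarrow> nat \<Rightarrow> nat list set \<Rightarrow> store \<Rightarrow> bool" where
  "holds_counts d n K s \<longleftrightarrow>
     (\<forall>I t. I \<subseteq> {..<d} \<and> length t = d \<and> set t \<subseteq> {..<n} \<longrightarrow>
        s ''N'' (code n I t) = card (extensions K I t)) \<and>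
     (\<forall>v<n. s ''M'' v = of_bool (v \<in> \<Union> (set ` K)))"

text \<open>The global program invariant. \<open>K\<close> is a ghost set: the store reflects it
  only through the counters \<open>''N''\<close> and the vertex marks \<open>''M''\<close>.\<close>

definition selection ::
    "nat \<Rightarrow> nat \<Rightarrow> nat \<Rightarrow> (nat \<Rightarrow> nat \<Rightarrow> bool) \<Rightarrow> nat list set \<Rightarrow> store \<Rightarrow> bool" where
  "selection c n k adj K s \<longleftrightarrow> holds_input n k adj s \<and> holds_tables (c + 2) n k s \<and>
     holds_counts (c + 2) n K s \<and> (\<forall>t\<in>K. obstruction c n adj t) \<and> capped (c + 2) k K"

lemma selection_cong:
  assumes "selection c n k adj K s"
    and "\<And>y. y \<notin> {''x'', ''i'', ''L'', ''l'', ''w''} \<Longrightarrow> s' y = s y"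
  shows "selection c n k adj K s'"
proof -
  have "s' ''n'' = s ''n''" "s' ''k'' = s ''k''" "s' ''A'' = s ''A''" "s' ''r'' = s ''r''"
    "s' ''c'' = s ''c''" "s' ''N'' = s ''N''" "s' ''M'' = s ''M''" "\<And>j. s' (table j) = s (table j)"
    using assms(2) by auto
  then show ?thesis
    using assms(1)
    by (simp add: selection_def holds_input_def holds_tables_def holds_counts_def)
qed

lemma selection_upd [simp]:
  assumes "x \<in> {''x'', ''i'', ''L'', ''l'', ''w''}"
  shows "selection c n k adj K (s(x := g)) \<longleftrightarrow> selection c n k adj K s"
proof
  assume "selection c n k adj K (s(x := g))"
  then show "selection c n k adj K s"
    by (rule selection_cong) (use assms in auto)
next
  assume "selection c n k adj K s"
  then show "selection c n k adj K (s(x := g))"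
    by (rule selection_cong) (use assms in auto)
qed

section \<open>Testing and recording a single tuple\<close>

definition address :: "nat list \<Rightarrow> aexp" where
  "address js = foldr (\<lambda>j a. Add (Read (table j) (Read ''x'' (Const j))) a) js (Const 0)"

text \<open>The positions \<open>js\<close> belong to the program text, so the address of a counter
  is one expression of fixed size, summing table entries.\<close>

lemma aval_address:
  assumes "holds_tables d n k s" "distinct js" "set js \<subseteq> {..<d}" "\<And>j. j < d \<Longrightarrow> s ''x'' j < n"
  shows "aval (address js) s = code n (set js) (map (s ''x'') [0..<d])"
  using assms(2,3)
proof (induction js)
  case (Cons j js)
  then show ?case
    using assms(1,4) by (auto simp: address_def code_def holds_tables_def)
qed (simp add: address_def code_def)

text \<open>All \<open>2 ^ d\<close> position sets, enumerated as increasing lists, are checked in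
  one boolean expression whose size depends only on \<open>d\<close>.\<close>

definition unsaturated_test :: "nat \<Rightarrow> bexp" where
  "unsaturated_test d = foldr (\<lambda>js b. Conj
     (Less (Read ''N'' (address js)) (Read ''c'' (Const (d - length js)))) b)
     (subseqs [0..<d]) (Less (Const 0) (Const 1))"

definition count_tuple :: "nat list list \<Rightarrow> com" where
  "count_tuple jss = seqs (map (\<lambda>js.
     Write ''N'' (address js) (Add (Read ''N'' (address js)) (Const 1))) jss)"

definition mark_tuple :: "nat list \<Rightarrow> com" where
  "mark_tuple js = seqs (map (\<lambda>j. Write ''M'' (Read ''x'' (Const j)) (Const 1)) js)"

definition select :: "nat \<Rightarrow> com" where
  "select d = Cond (unsaturated_test d)
     (Seq (count_tuple (subseqs [0..<d])) (mark_tuple [0..<d])) Skip"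

lemma bval_conjs: "bval (foldr (\<lambda>x b. Conj (F x) b) xs (Less (Const 0) (Const 1))) s \<longleftrightarrow>
    (\<forall>x\<in>set xs. bval (F x) s)"
  by (induction xs) auto

lemma address_cong:
  assumes "s' ''x'' = s ''x''" "\<And>j. s' (table j) = s (table j)"
  shows "aval (address js) s' = aval (address js) s"
  using assms by (induction js) (auto simp: address_def)

lemma subseqs_upt:
  assumes "js \<in> set (subseqs [0..<d])"
  shows "distinct js" "set js \<subseteq> {..<d}"
  using assms subseqs_distinctD[of js "[0..<d]"] imageI[OF assms, of set]
  by (simp_all add: subseqs_powset atLeast0LessThan)

text \<open>Distinct addresses ensure that no counter is incremented twice, and the increments leave
  the later addresses unchanged.\<close>

lemma runs_count_tuple:
  assumes "distinct (map (\<lambda>js. aval (address js) s) jss)"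
  shows "runs (count_tuple jss) s (length jss + 1) (\<lambda>s'.
    (\<forall>a. s' ''N'' a = s ''N'' a + of_bool (a \<in> (\<lambda>js. aval (address js) s) ` set jss)) \<and>
    (\<forall>y. y \<noteq> ''N'' \<longrightarrow> s' y = s y))"
  using assms
proof (induction jss arbitrary: s)
  case Nil
  then show ?case by (simp add: count_tuple_def)
next
  case (Cons js jss)
  let ?s = "s(''N'' := (s ''N'')(aval (address js) s := Suc (s ''N'' (aval (address js) s))))"
  have adr: "aval (address js') ?s = aval (address js') s" for js'
    by (rule address_cong) auto
  have "distinct (map (\<lambda>js. aval (address js) ?s) jss)"
    unfolding adr using Cons.prems by simp
  from Cons.IH[OF this] have "runs (count_tuple jss) ?s (length jss + 1) (\<lambda>s'.
    (\<forall>a. s' ''N'' a = s ''N'' a + of_bool (a \<in> (\<lambda>js. aval (address js) s) ` set (js # jss))) \<and>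
    (\<forall>y. y \<noteq> ''N'' \<longrightarrow> s' y = s y))"
    unfolding adr by (rule runs_mono) (use Cons.prems in auto)
  then show ?case by (simp add: count_tuple_def)
qed

lemma runs_mark_tuple:
  "runs (mark_tuple js) s (length js + 1) (\<lambda>s'.
    (\<forall>v. s' ''M'' v = (if v \<in> s ''x'' ` set js then 1 else s ''M'' v)) \<and>
    (\<forall>y. y \<noteq> ''M'' \<longrightarrow> s' y = s y))"
proof (induction js arbitrary: s)
  case Nil
  then show ?case by (simp add: mark_tuple_def)
next
  case (Cons j js)
  let ?s = "s(''M'' := (s ''M'')(s ''x'' j := 1))"
  have "runs (mark_tuple js) ?s (length js + 1) (\<lambda>s'.
    (\<forall>v. s' ''M'' v = (if v \<in> s ''x'' ` set (j # js) then 1 else s ''M'' v)) \<and>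
    (\<forall>y. y \<noteq> ''M'' \<longrightarrow> s' y = s y))"
    by (rule runs_mono[OF Cons.IH]) auto
  then show ?case by (simp add: mark_tuple_def)
qed

text \<open>A saturated tuple is skipped, any other is kept; either way it is saturated afterwards.
  The budget consists of one test, \<open>2 ^ d\<close> increments, \<open>d\<close> marks and two
  final \<open>Skip\<close>s, with \<open>d = c + 2\<close>.\<close>

lemma runs_select:
  assumes sel: "selection c n k adj K s"
    and t: "t = map (s ''x'') [0..<c + 2]" "obstruction c n adj t"
  shows "runs (select (c + 2)) s (2 ^ (c + 2) + (c + 2) + 3)
    (\<lambda>s'. \<exists>K'. K \<subseteq> K' \<and> selection c n k adj K' s' \<and> saturated (c + 2) k K' t \<and>
       (\<forall>y. y \<noteq> ''N'' \<and> y \<noteq> ''M'' \<longrightarrow> s' y = s y))"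
proof -
  define d where "d = c + 2"
  let ?subs = "subseqs [0..<d]"
  note sel' = sel[unfolded selection_def, folded d_def]
  have len: "length t = d" and tn: "set t \<subseteq> {..<n}"
    using t by (auto simp: obstruction_def d_def)
  have xn: "s ''x'' j < n" if "j < d" for j
    using tn that unfolding t(1) d_def[symmetric] by (auto simp: image_subset_iff)
  have adr: "aval (address js) s = code n (set js) t" if "js \<in> set ?subs" for js
    using aval_address[of d n k s js] sel' subseqs_upt[OF that] xn t(1) by (simp add: d_def)
  have pow: "set ` set ?subs = Pow {..<d}"
    by (simp add: subseqs_powset atLeast0LessThan)
  have card: "card (set js) = length js" if "js \<in> set ?subs" for js
    using subseqs_upt[OF that] by (simp add: distinct_card)
  have fin: "finite K" using sel' by (auto intro: finite_obstructions)
  have count: "s ''N'' (code n I t') = card (extensions K I t')"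
    if "I \<subseteq> {..<d}" "length t' = d" "set t' \<subseteq> {..<n}" for I t'
    using sel' that by (simp add: holds_counts_def)
  have test: "bval (unsaturated_test d) s \<longleftrightarrow> \<not> saturated d k K t"
  proof -
    have "bval (unsaturated_test d) s \<longleftrightarrow>
        (\<forall>js\<in>set ?subs. card (extensions K (set js) t) < cap d k (d - card (set js)))"
      unfolding unsaturated_test_def bval_conjs
      using sel' subseqs_upt len tn by (intro ball_cong refl) (simp add: adr card count holds_tables_def)
    also have "\<dots> \<longleftrightarrow> (\<forall>I\<in>set ` set ?subs. card (extensions K I t) < cap d k (d - card I))"
      by simp
    also have "\<dots> \<longleftrightarrow> \<not> saturated d k K t"
      unfolding pow saturated_def by (auto simp: not_le)
    finally show ?thesis .
  qed
  show ?thesis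
  proof (cases "saturated d k K t")
    case True
    then show ?thesis
      unfolding select_def d_def[symmetric] using test sel by auto
  next
    case False
    let ?K = "insert t K"
    have img: "(\<lambda>js. aval (address js) s) ` set ?subs = (\<lambda>I. code n I t) ` Pow {..<d}"
      unfolding pow[symmetric] image_image using adr by (intro image_cong) auto
    have inj: "inj_on (\<lambda>I. code n I t) (Pow {..<d})"
      using code_eq_iff[OF _ _ len tn len tn] by (auto simp: inj_on_def)
    have "distinct (map (\<lambda>I. code n I t) (map set ?subs))"
      unfolding distinct_map[of "\<lambda>I. code n I t"] using distinct_set_subseqs[of "[0..<d]"] inj pow by simp
    then have "distinct (map (\<lambda>js. aval (address js) s) ?subs)"
      using adr by (simp add: comp_def cong: map_cong)
    from runs_count_tuple[OF this]
    have run: "runs (Seq (count_tuple ?subs) (mark_tuple [0..<d])) s ((2 ^ d + 1) + (d + 1)) (\<lambda>s'.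
      (\<forall>a. s' ''N'' a = s ''N'' a + of_bool (a \<in> (\<lambda>I. code n I t) ` Pow {..<d})) \<and>
      (\<forall>v. s' ''M'' v = (if v \<in> set t then 1 else s ''M'' v)) \<and>
      (\<forall>y. y \<noteq> ''N'' \<and> y \<noteq> ''M'' \<longrightarrow> s' y = s y))"
    proof (rule runs_Seq[OF runs_mono[OF _ order_refl]])
      fix s\<^sub>1 assume s\<^sub>1: "(\<forall>a. s\<^sub>1 ''N'' a = s ''N'' a + of_bool (a \<in> (\<lambda>js. aval (address js) s) ` set ?subs)) \<and>
        (\<forall>y. y \<noteq> ''N'' \<longrightarrow> s\<^sub>1 y = s y)"
      have x: "s\<^sub>1 ''x'' ` set [0..<d] = set t" using s\<^sub>1 by (simp add: t(1) d_def)
      show "runs (mark_tuple [0..<d]) s\<^sub>1 (d + 1) (\<lambda>s'.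
        (\<forall>a. s' ''N'' a = s ''N'' a + of_bool (a \<in> (\<lambda>I. code n I t) ` Pow {..<d})) \<and>
        (\<forall>v. s' ''M'' v = (if v \<in> set t then 1 else s ''M'' v)) \<and>
        (\<forall>y. y \<noteq> ''N'' \<and> y \<noteq> ''M'' \<longrightarrow> s' y = s y))"
        using runs_mark_tuple[of "[0..<d]" s\<^sub>1] unfolding x
        by (rule runs_mono) (use s\<^sub>1 in \<open>simp_all flip: img\<close>)
    qed (simp_all add: length_subseqs)
    have "runs (Seq (count_tuple ?subs) (mark_tuple [0..<d])) s (2 ^ d + d + 2)
      (\<lambda>s'. \<exists>K'. K \<subseteq> K' \<and> selection c n k adj K' s' \<and> saturated d k K' t \<and>
       (\<forall>y. y \<noteq> ''N'' \<and> y \<noteq> ''M'' \<longrightarrow> s' y = s y))"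
    proof (rule runs_mono[OF run])
      fix s\<^sub>2
      assume "(\<forall>a. s\<^sub>2 ''N'' a = s ''N'' a + of_bool (a \<in> (\<lambda>I. code n I t) ` Pow {..<d})) \<and>
        (\<forall>v. s\<^sub>2 ''M'' v = (if v \<in> set t then 1 else s ''M'' v)) \<and>
        (\<forall>y. y \<noteq> ''N'' \<and> y \<noteq> ''M'' \<longrightarrow> s\<^sub>2 y = s y)"
      then have s2: "s\<^sub>2 ''N'' a = s ''N'' a + of_bool (a \<in> (\<lambda>I. code n I t) ` Pow {..<d})"
        "s\<^sub>2 ''M'' v = (if v \<in> set t then 1 else s ''M'' v)"
        "y \<noteq> ''N'' \<and> y \<noteq> ''M'' \<Longrightarrow> s\<^sub>2 y = s y" for a v y
        by simp_all
      \<comment> \<open>A kept tuple would be saturated through the full position set. Since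
        \<open>t\<close> is new, each matching set of extensions grows by exactly one, as its
        counter does.\<close>
      have "t \<notin> K"
      proof
        assume "t \<in> K"
        then have "0 < card (extensions K {..<d} t)"
          using fin by (auto simp: extensions_def card_gt_0_iff)
        then show False using False by (auto simp: saturated_def)
      qed
      have counts: "holds_counts d n ?K s\<^sub>2"
        unfolding holds_counts_def
      proof (intro conjI allI impI)
        fix I t' assume I: "I \<subseteq> {..<d} \<and> length t' = d \<and> set t' \<subseteq> {..<n}"
        \<comment> \<open>By injectivity of \<open>code\<close>, the incremented cells are exactly
          the counters of partial tuples that agree with \<open>t\<close>.\<close>
        have mem: "code n I t' \<in> (\<lambda>I. code n I t) ` Pow {..<d} \<longleftrightarrow> (\<forall>j\<in>I. t' ! j = t ! j)"
        proof -
          have "code n I t' = code n J t \<longleftrightarrow> I = J \<and> (\<forall>j\<in>I. t' ! j = t ! j)" if "J \<subseteq> {..<d}" for J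
            using code_eq_iff[of I d J t' n t] I that len tn by simp
          then show ?thesis using I by (auto simp: image_iff)
        qed
        have ext: "extensions ?K I t' = (if \<forall>j\<in>I. t' ! j = t ! j then insert t (extensions K I t') else extensions K I t')"
          by (auto simp: extensions_def)
        have "finite (extensions K I t')" "t \<notin> extensions K I t'"
          using fin \<open>t \<notin> K\<close> by (auto simp: extensions_def)
        then show "s\<^sub>2 ''N'' (code n I t') = card (extensions ?K I t')"
          unfolding s2 mem ext using count I by simp
      next
        fix v assume "v < n"
        then show "s\<^sub>2 ''M'' v = of_bool (v \<in> \<Union> (set ` ?K))"
          using sel' by (auto simp: s2 holds_counts_def)
      qed
      have "holds_input n k adj s\<^sub>2" "holds_tables d n k s\<^sub>2"
        using sel' by (auto simp: holds_input_def holds_tables_def s2)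
      then have "selection c n k adj ?K s\<^sub>2"
        unfolding selection_def d_def[symmetric]
        using counts sel' t(2) capped_insert[OF _ False fin] by simp
      moreover have "saturated d k ?K t"
        unfolding saturated_def
      proof (intro exI conjI)
        have "0 < card (extensions ?K {..<d} t)"
          using fin by (auto simp: extensions_def card_gt_0_iff)
        then show "cap d k (d - card {..<d}) \<le> card (extensions ?K {..<d} t)" by simp
      qed simp
      ultimately show "\<exists>K'. K \<subseteq> K' \<and> selection c n k adj K' s\<^sub>2 \<and> saturated d k K' t \<and>
         (\<forall>y. y \<noteq> ''N'' \<and> y \<noteq> ''M'' \<longrightarrow> s\<^sub>2 y = s y)"
        using s2(3) by (intro exI[of _ ?K]) auto
    qed simp
    then show ?thesis
      unfolding select_def d_def[symmetric] using test False by simp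
  qed
qed

section \<open>Enumerating obstructions\<close>

text \<open>With \<open>r\<close> positions left, the next one to fill is \<open>d - Suc r\<close>.
  Every inner loop starts just behind the counter of the enclosing one, so only increasing index
  lists are generated.\<close>

fun nest :: "nat \<Rightarrow> nat \<Rightarrow> aexp \<Rightarrow> com" where
  "nest d 0 a = select d"
| "nest d (Suc r) a = for_loop ''i'' (d - Suc r) a (var ''l'')
     (Seq (Write ''x'' (Const (d - Suc r)) (Read ''L'' (Read ''i'' (Const (d - Suc r)))))
       (nest d r (Add (Read ''i'' (Const (d - Suc r))) (Const 1))))"

text \<open>Each level has at most \<open>k + c\<close> iterations; the 3 counts the assignment to
  \<open>''x''\<close>, the loop test and the increment.\<close>

fun nest_time :: "nat \<Rightarrow> nat \<Rightarrow> nat \<Rightarrow> nat" where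
  "nest_time c k 0 = 2 ^ (c + 2) + (c + 2) + 3"
| "nest_time c k (Suc r) = (k + c) * (nest_time c k r + 3) + 2"

definition candidates :: "nat \<Rightarrow> nat \<Rightarrow> nat \<Rightarrow> (nat \<Rightarrow> nat \<Rightarrow> bool) \<Rightarrow> nat \<Rightarrow> nat \<Rightarrow> nat \<Rightarrow> (nat \<Rightarrow> nat) \<Rightarrow> bool" where
  "candidates c n k adj u v l L \<longleftrightarrow> u < n \<and> v < n \<and> u \<noteq> v \<and> \<not> adj u v \<and> l \<le> k + c \<and>
     inj_on L {..<l} \<and> (\<forall>i<l. L i < n \<and> adj u (L i) \<and> adj v (L i))"

lemma sorted_candidates_obstruction:
  assumes cand: "candidates c n k adj u v l L"
    and js: "sorted_wrt (<) js" "\<forall>j\<in>set js. j < l" "length js = c"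
  shows "obstruction c n adj (u # v # map L js)"
proof -
  have "inj_on L (set js)"
    using cand js(2) by (auto simp: candidates_def intro: inj_on_subset)
  moreover have "distinct js"
    using js(1) strict_sorted_iff by auto
  ultimately show ?thesis
    using cand js by (auto simp: obstruction_def candidates_def distinct_map)
qed

text \<open>Induction on the number of open positions, for an arbitrary prefix \<open>js\<close> of
  chosen indices. The frame conditions on the cells below \<open>p\<close> protect the prefix and
  the counters of the enclosing loops.\<close>

lemma runs_nest:
  assumes "r \<le> c" "d = c + 2" "p = d - r" "selection c n k adj K s"
    and "candidates c n k adj u v l L" "s ''l'' 0 = l" "s ''L'' = L" "aval a s \<le> l"
    and "map (s ''x'') [0..<p] = u # v # map L js" "sorted_wrt (<) js" "\<forall>j\<in>set js. j < aval a s"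
  shows "runs (nest d r a) s (nest_time c k r) (\<lambda>s'. \<exists>K'. K \<subseteq> K' \<and> selection c n k adj K' s' \<and>
    (\<forall>is. length is = r \<and> sorted_wrt (<) is \<and> set is \<subseteq> {aval a s..<l} \<longrightarrow>
      saturated d k K' (u # v # map L (js @ is))) \<and>
    (\<forall>y. y \<notin> {''N'', ''M'', ''x'', ''i''} \<longrightarrow> s' y = s y) \<and>
    (\<forall>q<p. s' ''x'' q = s ''x'' q \<and> s' ''i'' q = s ''i'' q))"
  using assms
proof (induction r arbitrary: K s a p js)
  case 0
  note d = \<open>d = c + 2\<close>
  \<comment> \<open>With no position open, \<open>p = d\<close>, so comparing lengths shows that
    exactly \<open>c\<close> indices have been chosen.\<close>
  have "length (map (s ''x'') [0..<p]) = length (u # v # map L js)" using 0 by (simp only:)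
  then have "length js = c" using 0 by simp
  moreover have "\<forall>j\<in>set js. j < l" using 0 by auto
  ultimately have "obstruction c n adj (u # v # map L js)"
    using 0 by (intro sorted_candidates_obstruction[of c n k adj u v l]) auto
  then have obs: "obstruction c n adj (map (s ''x'') [0..<c + 2])"
    using 0 by (simp only: minus_nat.diff_0)
  have t: "map (s ''x'') [0..<c + 2] = u # v # map L js"
    using 0 by (simp only: minus_nat.diff_0)
  show ?case
    unfolding nest.simps nest_time.simps d
    by (rule runs_mono[OF runs_select[OF \<open>selection c n k adj K s\<close> refl obs, unfolded t] order_refl])
      auto
next
  case (Suc r)
  note d = \<open>d = c + 2\<close>
  have p: "d - Suc r = p" "Suc p = d - r" "p = Suc (Suc (length js))"
  proof -
    show "d - Suc r = p" "Suc p = d - r" using Suc.prems by simp_all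
    have "length (map (s ''x'') [0..<p]) = length (u # v # map L js)" using Suc.prems by (simp only:)
    then show "p = Suc (Suc (length js))" by simp
  qed
  note cand = \<open>candidates c n k adj u v l L\<close>
  let ?Inv = "\<lambda>i s'. \<exists>K'. K \<subseteq> K' \<and> selection c n k adj K' s' \<and>
    (\<forall>is. length is = Suc r \<and> sorted_wrt (<) is \<and> set is \<subseteq> {aval a s..<l} \<and> hd is < i \<longrightarrow>
      saturated d k K' (u # v # map L (js @ is))) \<and> aval a s \<le> i \<and>
    (\<forall>y. y \<notin> {''N'', ''M'', ''x'', ''i''} \<longrightarrow> s' y = s y) \<and>
    (\<forall>q<p. s' ''x'' q = s ''x'' q \<and> s' ''i'' q = s ''i'' q)"
  show ?case
    unfolding nest.simps p(1)
  proof (rule runs_for_loop[where Inv = ?Inv and N = l and T = "1 + nest_time c k r"])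
    \<comment> \<open>The invariant speaks of continuations whose first index was already visited;
      at the start there are none.\<close>
    have vac: "\<not> hd is < aval a s" if "length is = Suc r" "set is \<subseteq> {aval a s..<l}" for "is"
      using that by (cases "is") auto
    show "?Inv (aval a s) (s(''i'' := (s ''i'')(p := aval a s)))"
      using Suc.prems(4) vac by (intro exI[of _ K]) auto
    show "aval a s \<le> l" by fact
    show "l * (1 + nest_time c k r + 2) + 2 \<le> nest_time c k (Suc r)"
      using mult_le_mono1[of l "k + c" "nest_time c k r + 3"] cand
      by (simp add: candidates_def algebra_simps)
  next
    fix i s' assume "?Inv i s'"
    then have "s' ''l'' = s ''l''" by (elim exE conjE) simp
    then show "aval (var ''l'') s' = l" using Suc.prems(6) by simp
  next
    fix s' assume "?Inv l s'"
    then obtain K' where K': "K \<subseteq> K'" "selection c n k adj K' s'"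
      "\<forall>is. length is = Suc r \<and> sorted_wrt (<) is \<and> set is \<subseteq> {aval a s..<l} \<and> hd is < l \<longrightarrow>
         saturated d k K' (u # v # map L (js @ is))"
      "\<forall>y. y \<notin> {''N'', ''M'', ''x'', ''i''} \<longrightarrow> s' y = s y"
      "\<forall>q<p. s' ''x'' q = s ''x'' q \<and> s' ''i'' q = s ''i'' q" by (elim exE conjE)
    have "hd is < l" if "length is = Suc r" "set is \<subseteq> {aval a s..<l}" for "is"
      using that by (cases "is") auto
    with K' show "\<exists>K'. K \<subseteq> K' \<and> selection c n k adj K' s' \<and>
      (\<forall>is. length is = Suc r \<and> sorted_wrt (<) is \<and> set is \<subseteq> {aval a s..<l} \<longrightarrow>
        saturated d k K' (u # v # map L (js @ is))) \<and>
      (\<forall>y. y \<notin> {''N'', ''M'', ''x'', ''i''} \<longrightarrow> s' y = s y) \<and>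
      (\<forall>q<p. s' ''x'' q = s ''x'' q \<and> s' ''i'' q = s ''i'' q)"
      by (intro exI[of _ K']) simp
  next
    fix i s\<^sub>1 assume i: "i < l" and "?Inv i s\<^sub>1" and si: "s\<^sub>1 ''i'' p = i"
    then obtain K' where K': "K \<subseteq> K'" "selection c n k adj K' s\<^sub>1"
      "\<forall>is. length is = Suc r \<and> sorted_wrt (<) is \<and> set is \<subseteq> {aval a s..<l} \<and> hd is < i \<longrightarrow>
         saturated d k K' (u # v # map L (js @ is))"
      and frame: "\<forall>y. y \<notin> {''N'', ''M'', ''x'', ''i''} \<longrightarrow> s\<^sub>1 y = s y"
      "\<forall>q<p. s\<^sub>1 ''x'' q = s ''x'' q \<and> s\<^sub>1 ''i'' q = s ''i'' q" and ai: "aval a s \<le> i" by (elim exE conjE)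
    have sL: "s\<^sub>1 ''L'' = L" "s\<^sub>1 ''l'' 0 = l" using frame(1) Suc.prems(6,7) by simp_all
    let ?s = "s\<^sub>1(''x'' := (s\<^sub>1 ''x'')(p := L i))"
    let ?a = "Add (Read ''i'' (Const p)) (Const 1)"
    have a: "aval ?a ?s = Suc i" using si by simp
    have "map (?s ''x'') [0..<Suc p] = map (s ''x'') [0..<p] @ [L i]"
      using frame by simp
    also have "\<dots> = u # v # map L (js @ [i])" using Suc.prems(9) by simp
    finally have x: "map (?s ''x'') [0..<Suc p] = u # v # map L (js @ [i])" .
    have "runs (nest d r ?a) ?s (nest_time c k r) (\<lambda>s'. \<exists>K''. K' \<subseteq> K'' \<and> selection c n k adj K'' s' \<and>
      (\<forall>is. length is = r \<and> sorted_wrt (<) is \<and> set is \<subseteq> {aval ?a ?s..<l} \<longrightarrow>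
        saturated d k K'' (u # v # map L ((js @ [i]) @ is))) \<and>
      (\<forall>y. y \<notin> {''N'', ''M'', ''x'', ''i''} \<longrightarrow> s' y = ?s y) \<and>
      (\<forall>q<Suc p. s' ''x'' q = ?s ''x'' q \<and> s' ''i'' q = ?s ''i'' q))"
    proof (rule Suc.IH)
      show "r \<le> c" "d = c + 2" "Suc p = d - r" using Suc.prems p by simp_all
      show "selection c n k adj K' ?s" using K' by simp
      show "candidates c n k adj u v l L" by fact
      show "?s ''l'' 0 = l" "?s ''L'' = L" using sL by simp_all
      show "aval ?a ?s \<le> l" using a i by simp
      show "map (?s ''x'') [0..<Suc p] = u # v # map L (js @ [i])" by (rule x)
      show "sorted_wrt (<) (js @ [i])"
        using Suc.prems(10,11) ai by (auto simp: sorted_wrt_append)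
      show "\<forall>j\<in>set (js @ [i]). j < aval ?a ?s"
        unfolding a using Suc.prems(11) ai by auto
    qed
    then have "runs (nest d r ?a) ?s (nest_time c k r)
      (\<lambda>s'. s' ''i'' p = i \<and> ?Inv (Suc i) (s'(''i'' := (s' ''i'')(p := Suc i))))"
    proof (rule runs_mono[OF _ order_refl], unfold a)
      fix s'
      assume "\<exists>K''. K' \<subseteq> K'' \<and> selection c n k adj K'' s' \<and>
        (\<forall>is. length is = r \<and> sorted_wrt (<) is \<and> set is \<subseteq> {Suc i..<l} \<longrightarrow>
          saturated d k K'' (u # v # map L ((js @ [i]) @ is))) \<and>
        (\<forall>y. y \<notin> {''N'', ''M'', ''x'', ''i''} \<longrightarrow> s' y = ?s y) \<and>
        (\<forall>q<Suc p. s' ''x'' q = ?s ''x'' q \<and> s' ''i'' q = ?s ''i'' q)"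
      then obtain K'' where K'': "K' \<subseteq> K''" "selection c n k adj K'' s'"
        "\<forall>is. length is = r \<and> sorted_wrt (<) is \<and> set is \<subseteq> {Suc i..<l} \<longrightarrow>
          saturated d k K'' (u # v # map L ((js @ [i]) @ is))"
        and frame': "\<forall>y. y \<notin> {''N'', ''M'', ''x'', ''i''} \<longrightarrow> s' y = ?s y"
        "\<forall>q<Suc p. s' ''x'' q = ?s ''x'' q \<and> s' ''i'' q = ?s ''i'' q" by (elim exE conjE)
      have fin: "finite K''"
        using K''(2) by (auto simp: selection_def intro: finite_obstructions)
      \<comment> \<open>A first index below \<open>i\<close> was handled in an earlier iteration and
        persists by monotonicity; first index \<open>i\<close> is the work of the inner
        loops.\<close>
      have sat: "saturated d k K'' (u # v # map L (js @ is))"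
        if h: "length is = Suc r" "sorted_wrt (<) is" "set is \<subseteq> {aval a s..<l}" "hd is < Suc i" for "is"
      proof (cases "hd is < i")
        case True
        then show ?thesis using saturated_mono[OF K'(3)[rule_format] K''(1) fin] h by simp
      next
        case False
        then obtain is' where "is": "is = i # is'" using h by (cases "is") auto
        then have "length is' = r \<and> sorted_wrt (<) is' \<and> set is' \<subseteq> {Suc i..<l}"
          using h by (auto simp: subset_iff Suc_le_eq)
        from K''(3)[rule_format, OF this] show ?thesis using "is" by simp
      qed
      have "?Inv (Suc i) (s'(''i'' := (s' ''i'')(p := Suc i)))"
        using K'(1) K''(1,2) sat ai frame frame' by (intro exI[of _ K'']) auto
      moreover have "s' ''i'' p = i" using frame' si by simp
      ultimately show "s' ''i'' p = i \<and> ?Inv (Suc i) (s'(''i'' := (s' ''i'')(p := Suc i)))" by blast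
    qed
    then show "runs (Seq (Write ''x'' (Const p) (Read ''L'' (Read ''i'' (Const p)))) (nest d r ?a)) s\<^sub>1
      (1 + nest_time c k r) (\<lambda>s'. s' ''i'' p = i \<and> ?Inv (Suc i) (s'(''i'' := (s' ''i'')(p := Suc i))))"
      using sL si by simp
  qed
qed

section \<open>Collecting common neighbors of a pair\<close>

definition collect_common :: "nat \<Rightarrow> com" where
  "collect_common c = Seq (Write ''l'' (Const 0) (Const 0))
     (for_loop ''w'' 0 (Const 0) (var ''n'')
       (Cond (Conj (Less (Const 0) (Read ''A'' (Add (Read ''r'' (Read ''x'' (Const 0))) (var ''w''))))
             (Conj (Less (Const 0) (Read ''A'' (Add (Read ''r'' (Read ''x'' (Const 1))) (var ''w''))))
               (Less (var ''l'') (Add (var ''k'') (Const c)))))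
         (Seq (Write ''L'' (var ''l'') (var ''w'')) (Write ''l'' (Const 0) (Add (var ''l'') (Const 1))))
         Skip))"

lemma selection_reads:
  assumes "selection c n k adj K s"
  shows "s ''n'' 0 = n" "s ''k'' 0 = k" "i < n \<Longrightarrow> s ''r'' i = i * n"
    "i < n \<Longrightarrow> j < n \<Longrightarrow> s ''A'' (i * n + j) = of_bool (adj i j)"
  using assms by (auto simp: selection_def holds_input_def holds_tables_def)

text \<open>Storing stops at \<open>k + c\<close> entries, which bounds the nested loops in terms of
  \<open>k\<close> and still suffices for \<open>covers\<close>. Hence the alternative in the
  conclusion: the list is complete or full.\<close>

lemma runs_collect_common:
  assumes "selection c n k adj K s" "s ''x'' 0 = u" "s ''x'' 1 = v" "u < n" "v < n"
  shows "runs (collect_common c) s (5 * n + 3) (\<lambda>s'. selection c n k adj K s' \<and> s' ''x'' = s ''x'' \<and>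
    s' ''l'' 0 \<le> k + c \<and> inj_on (s' ''L'') {..<s' ''l'' 0} \<and>
    s' ''L'' ` {..<s' ''l'' 0} \<subseteq> {w. w < n \<and> adj u w \<and> adj v w} \<and>
    (s' ''L'' ` {..<s' ''l'' 0} = {w. w < n \<and> adj u w \<and> adj v w} \<or> s' ''l'' 0 = k + c))"
proof -
  define good where "good l L i \<longleftrightarrow> l \<le> k + c \<and> inj_on L {..<l} \<and>
    L ` {..<l} \<subseteq> {w. w < i \<and> adj u w \<and> adj v w} \<and>
    (L ` {..<l} = {w. w < i \<and> adj u w \<and> adj v w} \<or> l = k + c)" for l L i
  let ?Inv = "\<lambda>i s'. selection c n k adj K s' \<and> s' ''x'' = s ''x'' \<and> good (s' ''l'' 0) (s' ''L'') i"
  let ?s = "s(''l'' := (s ''l'')(0 := 0))"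
  have "runs (for_loop ''w'' 0 (Const 0) (var ''n'')
       (Cond (Conj (Less (Const 0) (Read ''A'' (Add (Read ''r'' (Read ''x'' (Const 0))) (var ''w''))))
             (Conj (Less (Const 0) (Read ''A'' (Add (Read ''r'' (Read ''x'' (Const 1))) (var ''w''))))
               (Less (var ''l'') (Add (var ''k'') (Const c)))))
         (Seq (Write ''L'' (var ''l'') (var ''w'')) (Write ''l'' (Const 0) (Add (var ''l'') (Const 1))))
         Skip)) ?s (5 * n + 2) (?Inv n)"
  proof (rule runs_for_loop[where Inv = ?Inv and N = n and T = 3])
    show "?Inv (aval (Const 0) ?s) (?s(''w'' := (?s ''w'')(0 := aval (Const 0) ?s)))"
      using assms by (simp add: good_def)
  next
    fix i s' assume i: "i < n" and inv: "?Inv i s'" and w: "s' ''w'' 0 = i"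
    note rd = selection_reads[OF conjunct1[OF inv]]
    have x: "s ''x'' 0 = u" "s ''x'' (Suc 0) = v" using assms by simp_all
    let ?l = "s' ''l'' 0" and ?L = "s' ''L''"
    have A: "s' ''A'' (u * n + i) = of_bool (adj u i)" "s' ''A'' (v * n + i) = of_bool (adj v i)"
      using rd assms i by simp_all
    have img: "(?L(?l := i)) ` {..<Suc ?l} = insert i (?L ` {..<?l})"
      by (auto simp: lessThan_Suc)
    have g: "good ?l ?L i" using inv by simp
    then have notin: "i \<notin> ?L ` {..<?l}" by (auto simp: good_def)
    then have inj: "inj_on (?L(?l := i)) {..<Suc ?l}"
      using g by (auto simp: good_def lessThan_Suc inj_on_def)
    have step: "{w. w < Suc i \<and> adj u w \<and> adj v w} =
        (if adj u i \<and> adj v i then insert i {w. w < i \<and> adj u w \<and> adj v w} else {w. w < i \<and> adj u w \<and> adj v w})"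
      by (auto simp: less_Suc_eq)
    have keep: "good (Suc ?l) (?L(?l := i)) (Suc i)" if "adj u i \<and> adj v i \<and> ?l < k + c"
    proof -
      have "?L ` {..<?l} = {w. w < i \<and> adj u w \<and> adj v w}" using g that by (simp add: good_def)
      then have e: "(?L(?l := i)) ` {..<Suc ?l} = {w. w < Suc i \<and> adj u w \<and> adj v w}"
        unfolding img step using that by simp
      show ?thesis unfolding good_def e using that by (intro conjI inj disjI1 refl order_refl) simp
    qed
    \<comment> \<open>Either \<open>i\<close> is no common neighbor and the target set is unchanged,
      or \<open>?l \<le> k + c\<close> forces the list to be full.\<close>
    have skip: "good ?l ?L (Suc i)" if "\<not> (adj u i \<and> adj v i \<and> ?l < k + c)"
      using g that unfolding good_def by (auto simp: step)
    show "runs (Cond (Conj (Less (Const 0) (Read ''A'' (Add (Read ''r'' (Read ''x'' (Const 0))) (var ''w''))))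
             (Conj (Less (Const 0) (Read ''A'' (Add (Read ''r'' (Read ''x'' (Const 1))) (var ''w''))))
               (Less (var ''l'') (Add (var ''k'') (Const c)))))
         (Seq (Write ''L'' (var ''l'') (var ''w'')) (Write ''l'' (Const 0) (Add (var ''l'') (Const 1))))
         Skip) s' 3 (\<lambda>s'. s' ''w'' 0 = i \<and> ?Inv (Suc i) (s'(''w'' := (s' ''w'')(0 := Suc i))))"
    proof (cases "adj u i \<and> adj v i \<and> ?l < k + c")
      case True
      then show ?thesis
        using inv keep by (simp add: x w rd A assms(4,5))
    next
      case False
      then show ?thesis
        using inv skip by (auto simp: x w rd A assms(4,5))
    qed
  qed (auto simp: selection_reads)
  then show ?thesis by (simp add: collect_common_def good_def)
qed

text \<open>Inequality of the two entries is expressed by the two strict comparisons; a matrix entry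
  below 1 means nonadjacent.\<close>

definition process_pair :: "nat \<Rightarrow> com" where
  "process_pair c = Cond (Conj (Neg (Conj (Neg (Less (Read ''x'' (Const 0)) (Read ''x'' (Const 1))))
       (Neg (Less (Read ''x'' (Const 1)) (Read ''x'' (Const 0))))))
       (Less (Read ''A'' (Add (Read ''r'' (Read ''x'' (Const 0))) (Read ''x'' (Const 1)))) (Const 1)))
     (Seq (collect_common c) (nest (c + 2) c (Const 0))) Skip"

text \<open>The sorted indices of the elements of \<open>C\<close> form one of the enumerated lists,
  which supplies the single ordering that \<open>covers\<close> asks for.\<close>

lemma candidates_cover:
  assumes sub: "L ` {..<l} \<subseteq> {w. w < n \<and> adj u w \<and> adj v w}"
    and full: "L ` {..<l} = {w. w < n \<and> adj u w \<and> adj v w} \<or> l = k + c"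
    and inj: "inj_on L {..<l}"
    and sat: "\<And>is. length is = c \<Longrightarrow> sorted_wrt (<) is \<Longrightarrow> set is \<subseteq> {0..<l} \<Longrightarrow>
      saturated (c + 2) k K (u # v # map L is)"
  shows "covers c k n adj K u v"
  unfolding covers_def
proof (intro impI exI[of _ "L ` {..<l}"] conjI allI)
  show "L ` {..<l} \<subseteq> {w. w < n \<and> adj u w \<and> adj v w}" by (rule sub)
  show "L ` {..<l} = {w. w < n \<and> adj u w \<and> adj v w} \<or> k + c \<le> card (L ` {..<l})"
    using full inj by (auto simp: card_image)
next
  fix C assume C: "C \<subseteq> L ` {..<l}" "card C = c"
  let ?J = "{i \<in> {..<l}. L i \<in> C}"
  let ?is = "sorted_list_of_set ?J"
  have img: "L ` ?J = C" using C by auto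
  have "card ?J = card (L ` ?J)"
    using inj by (intro card_image[symmetric]) (auto simp: inj_on_def)
  then have "length ?is = c" using img C by simp
  moreover have "saturated (c + 2) k K (u # v # map L ?is)"
    by (rule sat) (use \<open>length ?is = c\<close> in auto)
  ultimately show "\<exists>ws. set ws = C \<and> length ws = c \<and> saturated (c + 2) k K (u # v # ws)"
    using img by (intro exI[of _ "map L ?is"]) simp
qed

lemma runs_process_pair:
  assumes sel: "selection c n k adj K s" and x: "s ''x'' 0 = u" "s ''x'' 1 = v" and uv: "u < n" "v < n"
  shows "runs (process_pair c) s (5 * n + 4 + nest_time c k c)
    (\<lambda>s'. \<exists>K'. K \<subseteq> K' \<and> selection c n k adj K' s' \<and> covers c k n adj K' u v \<and>
      s' ''x'' 0 = u \<and> s' ''x'' 1 = v)"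
proof (cases "u \<noteq> v \<and> \<not> adj u v")
  case False
  then have "covers c k n adj K u v" by (auto simp: covers_def)
  moreover have "s ''x'' (Suc 0) = v" using x by simp
  ultimately show ?thesis
    using False sel x uv selection_reads[OF sel] by (auto simp: process_pair_def)
next
  case True
  let ?Q = "\<lambda>s'. \<exists>K'. K \<subseteq> K' \<and> selection c n k adj K' s' \<and> covers c k n adj K' u v \<and>
      s' ''x'' 0 = u \<and> s' ''x'' 1 = v"
  have "runs (Seq (collect_common c) (nest (c + 2) c (Const 0))) s (5 * n + 3 + nest_time c k c) ?Q"
  proof (rule runs_Seq[OF runs_mono[OF runs_collect_common[OF sel x uv] order_refl] order_refl])
    fix s' :: store
    let ?l = "s' ''l'' 0" and ?L = "s' ''L''"
    assume A: "selection c n k adj K s' \<and> s' ''x'' = s ''x'' \<and>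
      ?l \<le> k + c \<and> inj_on ?L {..<?l} \<and>
      ?L ` {..<?l} \<subseteq> {w. w < n \<and> adj u w \<and> adj v w} \<and>
      (?L ` {..<?l} = {w. w < n \<and> adj u w \<and> adj v w} \<or> ?l = k + c)"
    then have cand: "candidates c n k adj u v ?l ?L"
      using True uv by (auto simp: candidates_def)
    have "[0..<c + 2 - c] = [0, 1]" by (simp add: upt_rec)
    then have pre: "map (s' ''x'') [0..<c + 2 - c] = u # v # map ?L []"
      using A x by (simp only: list.map)
    have "runs (nest (c + 2) c (Const 0)) s' (nest_time c k c)
      (\<lambda>s''. \<exists>K'. K \<subseteq> K' \<and> selection c n k adj K' s'' \<and>
        (\<forall>is. length is = c \<and> sorted_wrt (<) is \<and> set is \<subseteq> {aval (Const 0) s'..<?l} \<longrightarrow>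
          saturated (c + 2) k K' (u # v # map ?L ([] @ is))) \<and>
        (\<forall>y. y \<notin> {''N'', ''M'', ''x'', ''i''} \<longrightarrow> s'' y = s' y) \<and>
        (\<forall>q<c + 2 - c. s'' ''x'' q = s' ''x'' q \<and> s'' ''i'' q = s' ''i'' q))"
      by (rule runs_nest[OF order_refl refl refl conjunct1[OF A] cand refl refl _ pre]) auto
    then show "runs (nest (c + 2) c (Const 0)) s' (nest_time c k c) ?Q"
    proof (rule runs_mono[OF _ order_refl])
      fix s''
      assume "\<exists>K'. K \<subseteq> K' \<and> selection c n k adj K' s'' \<and>
        (\<forall>is. length is = c \<and> sorted_wrt (<) is \<and> set is \<subseteq> {aval (Const 0) s'..<?l} \<longrightarrow>
          saturated (c + 2) k K' (u # v # map ?L ([] @ is))) \<and>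
        (\<forall>y. y \<notin> {''N'', ''M'', ''x'', ''i''} \<longrightarrow> s'' y = s' y) \<and>
        (\<forall>q<c + 2 - c. s'' ''x'' q = s' ''x'' q \<and> s'' ''i'' q = s' ''i'' q)"
      then obtain K' where K': "K \<subseteq> K'" "selection c n k adj K' s''"
        "\<And>is. length is = c \<Longrightarrow> sorted_wrt (<) is \<Longrightarrow> set is \<subseteq> {0..<?l} \<Longrightarrow>
          saturated (c + 2) k K' (u # v # map ?L is)"
        "\<forall>q<c + 2 - c. s'' ''x'' q = s' ''x'' q" by auto
      have "covers c k n adj K' u v"
        by (rule candidates_cover[of ?L ?l]) (use A K'(3) in blast)+
      moreover have "s'' ''x'' 0 = u" "s'' ''x'' 1 = v"
        using K'(4) A x by auto
      ultimately show "?Q s''" using K' by blast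
    qed
  qed
  moreover have "s ''x'' (Suc 0) = v" using x by simp
  ultimately show ?thesis
    using True sel x uv selection_reads[OF sel] by (auto simp: process_pair_def elim: runs_mono)
qed

text \<open>The loop counters are the cells 0 and 1 of \<open>''x''\<close>, so the loops themselves
  fill in the first two entries of the tuple.\<close>

definition enumerate_pairs :: "nat \<Rightarrow> com" where
  "enumerate_pairs c = for_loop ''x'' 0 (Const 0) (var ''n'')
     (for_loop ''x'' 1 (Const 0) (var ''n'') (process_pair c))"

lemma runs_enumerate_pairs:
  assumes sel: "selection c n k adj K s"
  shows "runs (enumerate_pairs c) s (n * (n * (5 * n + 6 + nest_time c k c) + 4) + 2)
    (\<lambda>s'. \<exists>K'. selection c n k adj K' s' \<and> (\<forall>u<n. \<forall>v<n. covers c k n adj K' u v))"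
proof -
  let ?Inv = "\<lambda>u s'. \<exists>K'. selection c n k adj K' s' \<and> (\<forall>u'<u. \<forall>v<n. covers c k n adj K' u' v)"
  let ?Inv' = "\<lambda>u v s'. s' ''x'' 0 = u \<and> (\<exists>K'. selection c n k adj K' s' \<and>
    (\<forall>u'<u. \<forall>v<n. covers c k n adj K' u' v) \<and> (\<forall>v'<v. covers c k n adj K' u v'))"
  show ?thesis
    unfolding enumerate_pairs_def
  proof (rule runs_for_loop[where Inv = ?Inv and N = n and T = "n * (5 * n + 6 + nest_time c k c) + 2"])
    show "?Inv (aval (Const 0) s) (s(''x'' := (s ''x'')(0 := aval (Const 0) s)))"
      using sel by auto
  next
    fix u s' assume u: "u < n" "?Inv u s'" "s' ''x'' 0 = u"
    show "runs (for_loop ''x'' 1 (Const 0) (var ''n'') (process_pair c)) s'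
      (n * (5 * n + 6 + nest_time c k c) + 2)
      (\<lambda>s'. s' ''x'' 0 = u \<and> ?Inv (Suc u) (s'(''x'' := (s' ''x'')(0 := Suc u))))"
    proof (rule runs_for_loop[where Inv = "?Inv' u" and N = n and T = "5 * n + 4 + nest_time c k c"])
      show "?Inv' u (aval (Const 0) s') (s'(''x'' := (s' ''x'')(1 := aval (Const 0) s')))"
        using u by auto
    next
      fix v s'' assume v: "v < n" "?Inv' u v s''" "s'' ''x'' 1 = v"
      then obtain K' where K': "selection c n k adj K' s''"
        "\<forall>u'<u. \<forall>v<n. covers c k n adj K' u' v" "\<forall>v'<v. covers c k n adj K' u v'" by blast
      show "runs (process_pair c) s'' (5 * n + 4 + nest_time c k c)
        (\<lambda>s'. s' ''x'' 1 = v \<and> ?Inv' u (Suc v) (s'(''x'' := (s' ''x'')(1 := Suc v))))"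
      proof (rule runs_mono[OF runs_process_pair[OF K'(1) conjunct1[OF v(2)] v(3) u(1) v(1)] order_refl])
        fix t
        assume "\<exists>K''. K' \<subseteq> K'' \<and> selection c n k adj K'' t \<and> covers c k n adj K'' u v \<and>
          t ''x'' 0 = u \<and> t ''x'' 1 = v"
        then obtain K'' where K'': "K' \<subseteq> K''" "selection c n k adj K'' t" "covers c k n adj K'' u v"
          "t ''x'' 0 = u" "t ''x'' 1 = v" by blast
        have fin: "finite K''"
          using K''(2) by (auto simp: selection_def intro: finite_obstructions)
        have "\<forall>u'<u. \<forall>v<n. covers c k n adj K'' u' v" "\<forall>v'<Suc v. covers c k n adj K'' u v'"
          using K'(2,3) K''(3) covers_mono[OF _ K''(1) fin] less_Suc_eq by auto
        then show "t ''x'' 1 = v \<and> ?Inv' u (Suc v) (t(''x'' := (t ''x'')(1 := Suc v)))"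
          using K'' by auto
      qed
    next
      fix t assume "?Inv' u n t"
      then show "t ''x'' 0 = u \<and> ?Inv (Suc u) (t(''x'' := (t ''x'')(0 := Suc u)))"
        by (auto simp: less_Suc_eq)
    qed (auto simp: selection_reads)
  qed (auto simp: selection_reads algebra_simps)
qed

section \<open>Tables and output\<close>

text \<open>Multiplication by a number known from the program text, unfolded into additions.\<close>

fun scale :: "nat \<Rightarrow> aexp \<Rightarrow> aexp" where
  "scale 0 a = Const 0"
| "scale (Suc d) a = Add a (scale d a)"

lemma aval_scale [simp]: "aval (scale d a) s = d * aval a s"
  by (induction d) auto

text \<open>The factor \<open>k\<close> is only known at run time, so one step of the recursion of
  \<open>cap\<close> takes a loop of \<open>k\<close> additions.\<close>

definition cap_step :: "nat \<Rightarrow> nat \<Rightarrow> com" where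
  "cap_step d j = Seq (Write ''z'' (Const 0) (Const 1))
     (Seq (for_loop ''w'' 0 (Const 0) (var ''k'')
         (Write ''z'' (Const 0) (Add (var ''z'') (scale d (Read ''c'' (Const j))))))
       (Write ''c'' (Const (Suc j)) (var ''z'')))"

lemma runs_cap_step:
  assumes "s ''k'' 0 = k"
  shows "runs (cap_step d j) s (3 * k + 4) (\<lambda>s'. s' ''c'' = (s ''c'')(Suc j := 1 + d * k * s ''c'' j) \<and>
    (\<forall>y. y \<notin> {''c'', ''w'', ''z''} \<longrightarrow> s' y = s y))"
proof -
  let ?Inv = "\<lambda>i s'. s' ''z'' 0 = 1 + d * i * s ''c'' j \<and> (\<forall>y. y \<notin> {''w'', ''z''} \<longrightarrow> s' y = s y)"
  let ?s = "s(''z'' := (s ''z'')(0 := 1))"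
  have "runs (for_loop ''w'' 0 (Const 0) (var ''k'')
      (Write ''z'' (Const 0) (Add (var ''z'') (scale d (Read ''c'' (Const j)))))) ?s (3 * k + 2) (?Inv k)"
    by (rule runs_for_loop[where Inv = ?Inv and N = k and T = 1]) (use assms in \<open>auto simp: algebra_simps\<close>)
  then have "runs (Seq (for_loop ''w'' 0 (Const 0) (var ''k'')
      (Write ''z'' (Const 0) (Add (var ''z'') (scale d (Read ''c'' (Const j))))))
      (Write ''c'' (Const (Suc j)) (var ''z''))) ?s (3 + 3 * k)
      (\<lambda>s'. s' ''c'' = (s ''c'')(Suc j := 1 + d * k * s ''c'' j) \<and>
        (\<forall>y. y \<notin> {''c'', ''w'', ''z''} \<longrightarrow> s' y = s y))"
    by (rule runs_Seq[where T\<^sub>2 = 1, OF runs_mono[OF _ order_refl]]) auto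
  then show ?thesis by (simp add: cap_step_def)
qed

definition compute_caps :: "nat \<Rightarrow> com" where
  "compute_caps d = Seq (Write ''c'' (Const 0) (Const 1)) (seqs (map (cap_step d) [0..<d]))"

lemma runs_compute_caps:
  assumes k: "s ''k'' 0 = k"
  shows "runs (compute_caps d) s (d * (3 * k + 4) + 2) (\<lambda>s'. (\<forall>j\<le>d. s' ''c'' j = cap d k j) \<and>
    (\<forall>y. y \<notin> {''c'', ''w'', ''z''} \<longrightarrow> s' y = s y))"
proof -
  let ?Inv = "\<lambda>i s'. (\<forall>j\<le>i. s' ''c'' j = cap d k j) \<and> (\<forall>y. y \<notin> {''c'', ''w'', ''z''} \<longrightarrow> s' y = s y)"
  have "runs (seqs (map (cap_step d) [0..<d])) (s(''c'' := (s ''c'')(0 := 1))) (d * (3 * k + 4) + 1) (?Inv d)"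
  proof (rule runs_seqs[where Inv = ?Inv and T = "3 * k + 4"])
    fix j s' assume inv: "?Inv j s'"
    then have "s' ''k'' 0 = k" using k by auto
    then show "runs (cap_step d j) s' (3 * k + 4) (?Inv (Suc j))"
      by (rule runs_mono[OF runs_cap_step order_refl]) (use inv in \<open>auto simp: le_Suc_eq\<close>)
  qed auto
  then show ?thesis by (simp add: compute_caps_def)
qed

text \<open>\<open>''b''\<close> holds the current power of \<open>Suc n\<close> and
  \<open>''z''\<close> its running multiples. After the loop \<open>''z''\<close> is
  \<open>n\<close> times that power, so adding \<open>''b''\<close> once more yields the next
  power.\<close>

definition table_step :: "nat \<Rightarrow> com" where
  "table_step j = Seq (Write ''z'' (Const 0) (Const 0))
     (Seq (for_loop ''w'' 0 (Const 0) (var ''n'')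
         (Seq (Write ''z'' (Const 0) (Add (var ''z'') (var ''b''))) (Write (table j) (var ''w'') (var ''z''))))
       (Write ''b'' (Const 0) (Add (var ''z'') (var ''b''))))"

lemma runs_table_step:
  assumes "s ''n'' 0 = n"
  shows "runs (table_step j) s (4 * n + 4) (\<lambda>s'. (\<forall>v<n. s' (table j) v = Suc v * s ''b'' 0) \<and>
    s' ''b'' 0 = Suc n * s ''b'' 0 \<and> (\<forall>y. y \<notin> {''b'', ''w'', ''z'', table j} \<longrightarrow> s' y = s y))"
proof -
  let ?Inv = "\<lambda>i s'. s' ''z'' 0 = i * s ''b'' 0 \<and> (\<forall>v<i. s' (table j) v = Suc v * s ''b'' 0) \<and>
    (\<forall>y. y \<notin> {''w'', ''z'', table j} \<longrightarrow> s' y = s y)"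
  let ?s = "s(''z'' := (s ''z'')(0 := 0))"
  let ?P = "for_loop ''w'' 0 (Const 0) (var ''n'')
    (Seq (Write ''z'' (Const 0) (Add (var ''z'') (var ''b''))) (Write (table j) (var ''w'') (var ''z'')))"
  have "runs ?P ?s (4 * n + 2) (?Inv n)"
    by (rule runs_for_loop[where Inv = ?Inv and N = n and T = 2])
      (use assms in \<open>auto simp: less_Suc_eq\<close>)
  then have "runs (Seq ?P (Write ''b'' (Const 0) (Add (var ''z'') (var ''b'')))) ?s (3 + 4 * n)
    (\<lambda>s'. (\<forall>v<n. s' (table j) v = Suc v * s ''b'' 0) \<and>
      s' ''b'' 0 = Suc n * s ''b'' 0 \<and> (\<forall>y. y \<notin> {''b'', ''w'', ''z'', table j} \<longrightarrow> s' y = s y))"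
    by (rule runs_Seq[where T\<^sub>2 = 1, OF runs_mono[OF _ order_refl]]) auto
  then show ?thesis by (simp add: table_step_def)
qed

definition compute_tables :: "nat \<Rightarrow> com" where
  "compute_tables d = Seq (Write ''b'' (Const 0) (Const 1)) (seqs (map table_step [0..<d]))"

lemma runs_compute_tables:
  assumes n: "s ''n'' 0 = n"
  shows "runs (compute_tables d) s (d * (4 * n + 4) + 2)
    (\<lambda>s'. (\<forall>j<d. \<forall>v<n. s' (table j) v = Suc v * Suc n ^ j) \<and>
      (\<forall>y. y \<notin> {''b'', ''w'', ''z''} \<and> y \<notin> range table \<longrightarrow> s' y = s y))"
proof -
  let ?Inv = "\<lambda>i s'. s' ''b'' 0 = Suc n ^ i \<and> (\<forall>j<i. \<forall>v<n. s' (table j) v = Suc v * Suc n ^ j) \<and>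
    (\<forall>y. y \<notin> {''b'', ''w'', ''z''} \<and> y \<notin> range table \<longrightarrow> s' y = s y)"
  have "runs (seqs (map table_step [0..<d])) (s(''b'' := (s ''b'')(0 := 1))) (d * (4 * n + 4) + 1)
    (\<lambda>s'. (\<forall>j<d. \<forall>v<n. s' (table j) v = Suc v * Suc n ^ j) \<and>
      (\<forall>y. y \<notin> {''b'', ''w'', ''z''} \<and> y \<notin> range table \<longrightarrow> s' y = s y))"
  proof (rule runs_seqs[where Inv = ?Inv and T = "4 * n + 4"])
    fix j s' assume inv: "?Inv j s'"
    have "''n'' \<notin> range table" by auto
    then have "s' ''n'' 0 = n" using n inv by simp
    then show "runs (table_step j) s' (4 * n + 4) (?Inv (Suc j))"
    proof (rule runs_mono[OF runs_table_step order_refl])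
      fix s'' assume s'': "(\<forall>v<n. s'' (table j) v = Suc v * s' ''b'' 0) \<and>
        s'' ''b'' 0 = Suc n * s' ''b'' 0 \<and> (\<forall>y. y \<notin> {''b'', ''w'', ''z'', table j} \<longrightarrow> s'' y = s' y)"
      have "s'' (table i) v = Suc v * Suc n ^ i" if "i < Suc j" "v < n" for i v
        using that s'' inv by (cases "i = j") auto
      moreover have "s'' ''b'' 0 = Suc n ^ Suc j" using s'' inv by simp
      moreover have "s'' y = s y" if "y \<notin> {''b'', ''w'', ''z''}" "y \<notin> range table" for y
        using that s'' inv by auto
      ultimately show "?Inv (Suc j) s''" by blast
    qed
  qed auto
  then show ?thesis by (simp add: compute_tables_def)
qed

definition compute_rows :: com where
  "compute_rows = Seq (Write ''z'' (Const 0) (Const 0)) (for_loop ''w'' 0 (Const 0) (var ''n'')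
     (Seq (Write ''r'' (var ''w'') (var ''z'')) (Write ''z'' (Const 0) (Add (var ''z'') (var ''n'')))))"

lemma runs_compute_rows:
  assumes "s ''n'' 0 = n"
  shows "runs compute_rows s (4 * n + 3) (\<lambda>s'. (\<forall>i<n. s' ''r'' i = i * n) \<and>
    (\<forall>y. y \<notin> {''r'', ''w'', ''z''} \<longrightarrow> s' y = s y))"
proof -
  let ?Inv = "\<lambda>i s'. s' ''z'' 0 = i * n \<and> (\<forall>j<i. s' ''r'' j = j * n) \<and>
    (\<forall>y. y \<notin> {''r'', ''w'', ''z''} \<longrightarrow> s' y = s y)"
  have "runs (for_loop ''w'' 0 (Const 0) (var ''n'')
      (Seq (Write ''r'' (var ''w'') (var ''z'')) (Write ''z'' (Const 0) (Add (var ''z'') (var ''n'')))))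
      (s(''z'' := (s ''z'')(0 := 0))) (4 * n + 2)
      (\<lambda>s'. (\<forall>i<n. s' ''r'' i = i * n) \<and> (\<forall>y. y \<notin> {''r'', ''w'', ''z''} \<longrightarrow> s' y = s y))"
    by (rule runs_for_loop[where Inv = ?Inv and N = n and T = 2])
      (use assms in \<open>auto simp: less_Suc_eq\<close>)
  then show ?thesis by (simp add: compute_rows_def)
qed

text \<open>Cells of \<open>''N''\<close> and \<open>''M''\<close> are 0 on input and so already
  represent \<open>K = {}\<close>; no time is spent on initialising the counters.\<close>

lemma runs_setup:
  assumes inp: "holds_input n k adj s" and caps: "\<forall>j\<le>c + 2. s ''c'' j = cap (c + 2) k j"
    and zero: "\<And>i. s ''N'' i = 0" "\<And>i. s ''M'' i = 0"
  shows "runs (Seq (compute_tables (c + 2)) compute_rows) s ((c + 2) * (4 * n + 4) + 4 * n + 5)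
    (selection c n k adj {})"
proof (rule runs_Seq[OF runs_mono[OF runs_compute_tables order_refl]])
  show n: "s ''n'' 0 = n" using inp by (simp add: holds_input_def)
  fix s\<^sub>1
  assume s\<^sub>1: "(\<forall>j<c + 2. \<forall>v<n. s\<^sub>1 (table j) v = Suc v * Suc n ^ j) \<and>
    (\<forall>y. y \<notin> {''b'', ''w'', ''z''} \<and> y \<notin> range table \<longrightarrow> s\<^sub>1 y = s y)"
  have fr: "s\<^sub>1 y = s y" if "y \<in> {''n'', ''k'', ''A'', ''c'', ''N'', ''M''}" for y
  proof -
    have "y \<notin> range table" using that by auto
    moreover have "y \<notin> {''b'', ''w'', ''z''}" using that by auto
    ultimately show ?thesis using conjunct2[OF s\<^sub>1] by simp
  qed
  show "runs compute_rows s\<^sub>1 (4 * n + 3) (selection c n k adj {})"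
  proof (rule runs_mono[OF runs_compute_rows order_refl])
    show "s\<^sub>1 ''n'' 0 = n" using fr n by simp
    fix s\<^sub>2
    assume s\<^sub>2: "(\<forall>i<n. s\<^sub>2 ''r'' i = i * n) \<and> (\<forall>y. y \<notin> {''r'', ''w'', ''z''} \<longrightarrow> s\<^sub>2 y = s\<^sub>1 y)"
    have fr': "s\<^sub>2 y = s y" if "y \<in> {''n'', ''k'', ''A'', ''c'', ''N'', ''M''}" for y
    proof -
      have "y \<notin> {''r'', ''w'', ''z''}" using that by auto
      then show ?thesis using conjunct2[OF s\<^sub>2] fr[OF that] by simp
    qed
    have "holds_input n k adj s\<^sub>2" using inp fr' by (simp add: holds_input_def)
    moreover have "holds_tables (c + 2) n k s\<^sub>2"
      unfolding holds_tables_def using s\<^sub>1 s\<^sub>2 caps fr'[of "''c''"] by simp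
    moreover have "holds_counts (c + 2) n {} s\<^sub>2"
      using zero fr'[of "''N''"] fr'[of "''M''"] by (simp add: holds_counts_def extensions_def)
    ultimately show "selection c n k adj {} s\<^sub>2"
      by (simp add: selection_def capped_def extensions_def)
  qed
qed simp

section \<open>Writing the induced subgraph as output\<close>

definition gather :: com where
  "gather = Seq (Write ''l'' (Const 0) (Const 0)) (for_loop ''w'' 0 (Const 0) (var ''n'')
     (Cond (Less (Const 0) (Read ''M'' (var ''w'')))
       (Seq (Write ''L'' (var ''l'') (var ''w'')) (Write ''l'' (Const 0) (Add (var ''l'') (Const 1))))
       Skip))"

definition holds_list :: "store \<Rightarrow> nat list \<Rightarrow> bool" where
  "holds_list s ls \<longleftrightarrow> s ''l'' 0 = length ls \<and> (\<forall>i<length ls. s ''L'' i = ls ! i)"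

lemma runs_gather:
  assumes n: "s ''n'' 0 = n" and M: "\<forall>v<n. s ''M'' v = of_bool (v \<in> W)"
  shows "runs gather s (5 * n + 3) (\<lambda>s'. (\<exists>ls. holds_list s' ls \<and> distinct ls \<and> set ls = {v. v < n \<and> v \<in> W}) \<and>
    (\<forall>y. y \<notin> {''L'', ''l'', ''w''} \<longrightarrow> s' y = s y))"
proof -
  let ?Inv = "\<lambda>i s'. (\<exists>ls. holds_list s' ls \<and> distinct ls \<and> set ls = {v. v < i \<and> v \<in> W}) \<and>
    (\<forall>y. y \<notin> {''L'', ''l'', ''w''} \<longrightarrow> s' y = s y)"
  let ?s = "s(''l'' := (s ''l'')(0 := 0))"
  have "runs (for_loop ''w'' 0 (Const 0) (var ''n'')
     (Cond (Less (Const 0) (Read ''M'' (var ''w'')))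
       (Seq (Write ''L'' (var ''l'') (var ''w'')) (Write ''l'' (Const 0) (Add (var ''l'') (Const 1))))
       Skip)) ?s (5 * n + 2) (?Inv n)"
  proof (rule runs_for_loop[where Inv = ?Inv and N = n and T = 3])
    show "?Inv (aval (Const 0) ?s) (?s(''w'' := (?s ''w'')(0 := aval (Const 0) ?s)))"
      by (simp add: holds_list_def)
  next
    fix i s' assume i: "i < n" and inv: "?Inv i s'" and w: "s' ''w'' 0 = i"
    then obtain ls where ls: "holds_list s' ls" "distinct ls" "set ls = {v. v < i \<and> v \<in> W}" by blast
    have fr: "\<forall>y. y \<notin> {''L'', ''l'', ''w''} \<longrightarrow> s' y = s y" using inv by blast
    have m: "s ''M'' i = of_bool (i \<in> W)" using M i by simp
    show "runs (Cond (Less (Const 0) (Read ''M'' (var ''w'')))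
       (Seq (Write ''L'' (var ''l'') (var ''w'')) (Write ''l'' (Const 0) (Add (var ''l'') (Const 1))))
       Skip) s' 3 (\<lambda>s'. s' ''w'' 0 = i \<and> ?Inv (Suc i) (s'(''w'' := (s' ''w'')(0 := Suc i))))"
    proof (cases "i \<in> W")
      case True
      let ?t = "s'(''L'' := (s' ''L'')(s' ''l'' 0 := i), ''l'' := (s' ''l'')(0 := Suc (s' ''l'' 0)),
        ''w'' := (s' ''w'')(0 := Suc i))"
      have "holds_list ?t (ls @ [i])" using ls(1) by (auto simp: holds_list_def nth_append less_Suc_eq)
      moreover have "distinct (ls @ [i])" using ls by simp
      moreover have "set (ls @ [i]) = {v. v < Suc i \<and> v \<in> W}" using ls True by (auto simp: less_Suc_eq)
      ultimately have "?Inv (Suc i) ?t" using fr by auto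
      then show ?thesis using True w fr by (simp add: m)
    next
      case False
      let ?t = "s'(''w'' := (s' ''w'')(0 := Suc i))"
      have "holds_list ?t ls" using ls(1) by (simp add: holds_list_def)
      moreover have "set ls = {v. v < Suc i \<and> v \<in> W}" using ls False by (auto simp: less_Suc_eq)
      ultimately have "?Inv (Suc i) ?t" using fr ls by auto
      then show ?thesis using False w fr by (simp add: m)
    qed
  qed (use n in auto)
  then show ?thesis by (simp add: gather_def)
qed

text \<open>The new matrix is built in a separate array because entries of \<open>''A''\<close> are
  still read with the old row length. \<open>''z''\<close> runs through the new row-major positions
  without any multiplication.\<close>

definition copy_matrix :: com where
  "copy_matrix = Seq (Write ''z'' (Const 0) (Const 0)) (for_loop ''x'' 0 (Const 0) (var ''l'')
     (for_loop ''x'' 1 (Const 0) (var ''l'')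
       (Seq (Write ''B'' (var ''z'') (Read ''A'' (Add (Read ''r'' (Read ''L'' (Read ''x'' (Const 0))))
           (Read ''L'' (Read ''x'' (Const 1))))))
         (Write ''z'' (Const 0) (Add (var ''z'') (Const 1))))))"

lemma runs_copy_matrix:
  assumes ls: "holds_list s ls" "set ls \<subseteq> {..<n}" and r: "\<forall>i<n. s ''r'' i = i * n"
    and A: "\<forall>i<n. \<forall>j<n. s ''A'' (i * n + j) = of_bool (adj i j)" and m: "m = length ls"
  shows "runs copy_matrix s (m * (m * 4 + 4) + 3) (\<lambda>s'. s' ''z'' 0 = m * m \<and>
    (\<forall>p<m * m. s' ''B'' p = of_bool (adj (ls ! (p div m)) (ls ! (p mod m)))) \<and>
    (\<forall>y. y \<notin> {''B'', ''x'', ''z''} \<longrightarrow> s' y = s y))"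
proof -
  let ?g = "\<lambda>p. of_bool (adj (ls ! (p div m)) (ls ! (p mod m))) :: nat"
  let ?J = "\<lambda>q s'. s' ''z'' 0 = q \<and> (\<forall>p<q. s' ''B'' p = ?g p) \<and>
    (\<forall>y. y \<notin> {''B'', ''x'', ''z''} \<longrightarrow> s' y = s y)"
  let ?P = "Seq (Write ''B'' (var ''z'') (Read ''A'' (Add (Read ''r'' (Read ''L'' (Read ''x'' (Const 0))))
           (Read ''L'' (Read ''x'' (Const 1))))))
         (Write ''z'' (Const 0) (Add (var ''z'') (Const 1)))"
  have l: "s ''l'' 0 = m" using ls m by (simp add: holds_list_def)
  have "runs (for_loop ''x'' 0 (Const 0) (var ''l'') (for_loop ''x'' 1 (Const 0) (var ''l'') ?P))
    (s(''z'' := (s ''z'')(0 := 0))) (m * (m * 4 + 4) + 2) (?J (m * m))"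
  proof (rule runs_for_loop[where Inv = "\<lambda>i. ?J (i * m)" and N = m and T = "m * 4 + 2"])
    fix i s\<^sub>1 assume i: "i < m" and J: "?J (i * m) s\<^sub>1" and x: "s\<^sub>1 ''x'' 0 = i"
    show "runs (for_loop ''x'' 1 (Const 0) (var ''l'') ?P) s\<^sub>1 (m * 4 + 2)
      (\<lambda>s'. s' ''x'' 0 = i \<and> ?J (Suc i * m) (s'(''x'' := (s' ''x'')(0 := Suc i))))"
    proof (rule runs_for_loop[where Inv = "\<lambda>j s'. s' ''x'' 0 = i \<and> ?J (i * m + j) s'" and N = m and T = 2])
      fix j s\<^sub>2 assume j: "j < m" and J2: "s\<^sub>2 ''x'' 0 = i \<and> ?J (i * m + j) s\<^sub>2" and x2: "s\<^sub>2 ''x'' 1 = j"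
      have L: "s ''L'' i = ls ! i" "s ''L'' j = ls ! j"
        using ls(1) i j m by (simp_all add: holds_list_def)
      have lt: "ls ! i < n" "ls ! j < n" using ls(2) i j m by (auto simp: subset_iff)
      then have a: "s ''A'' (s ''r'' (ls ! i) + ls ! j) = of_bool (adj (ls ! i) (ls ! j))"
        using r A by simp
      have div: "(i * m + j) div m = i" "(i * m + j) mod m = j" using j by simp_all
      have x2': "s\<^sub>2 ''x'' (Suc 0) = j" using x2 by simp
      show "runs ?P s\<^sub>2 2 (\<lambda>s'. s' ''x'' 1 = j \<and>
        (s'(''x'' := (s' ''x'')(1 := Suc j))) ''x'' 0 = i \<and> ?J (i * m + Suc j) (s'(''x'' := (s' ''x'')(1 := Suc j))))"
        using J2 j by (simp add: x2' L a div less_Suc_eq)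
    next
      fix s\<^sub>2 assume "s\<^sub>2 ''x'' 0 = i \<and> ?J (i * m + m) s\<^sub>2"
      then show "s\<^sub>2 ''x'' 0 = i \<and> ?J (Suc i * m) (s\<^sub>2(''x'' := (s\<^sub>2 ''x'')(0 := Suc i)))"
        by (simp add: add.commute)
    qed (use J x l in auto)
  qed (use l in \<open>auto simp: algebra_simps\<close>)
  then show ?thesis by (simp add: copy_matrix_def)
qed

definition write_output :: com where
  "write_output = Seq gather (Seq copy_matrix
     (Seq (for_loop ''w'' 0 (Const 0) (var ''z'') (Write ''A'' (var ''w'') (Read ''B'' (var ''w''))))
       (Write ''n'' (Const 0) (var ''l''))))"

lemma runs_copy_back:
  "runs (for_loop ''w'' 0 (Const 0) (var ''z'') (Write ''A'' (var ''w'') (Read ''B'' (var ''w'')))) s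
    (3 * s ''z'' 0 + 2) (\<lambda>s'. (\<forall>p<s ''z'' 0. s' ''A'' p = s ''B'' p) \<and>
      (\<forall>y. y \<notin> {''A'', ''w''} \<longrightarrow> s' y = s y))"
  by (rule runs_for_loop[where N = "s ''z'' 0" and T = 1 and
      Inv = "\<lambda>i s'. (\<forall>p<i. s' ''A'' p = s ''B'' p) \<and> (\<forall>y. y \<notin> {''A'', ''w''} \<longrightarrow> s' y = s y)"])
    (auto simp: less_Suc_eq)

lemma runs_write_output:
  assumes sel: "selection c n k adj K s"
  shows "runs write_output s (7 * (n * n) + 9 * n + 9) (\<lambda>s'. \<exists>ls. distinct ls \<and> set ls = \<Union> (set ` K) \<and>
    holds_input (length ls) k (\<lambda>i j. adj (ls ! i) (ls ! j)) s')"
proof -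
  let ?W = "\<Union> (set ` K)"
  have W: "{v. v < n \<and> v \<in> ?W} = ?W"
    using sel unfolding selection_def obstruction_def by blast
  have M: "\<forall>v<n. s ''M'' v = of_bool (v \<in> ?W)"
    using sel by (simp add: selection_def holds_counts_def)
  note rd = selection_reads[OF sel]
  let ?Q = "\<lambda>s'. \<exists>ls. distinct ls \<and> set ls = ?W \<and>
    holds_input (length ls) k (\<lambda>i j. adj (ls ! i) (ls ! j)) s'"
  let ?B = "for_loop ''w'' 0 (Const 0) (var ''z'') (Write ''A'' (var ''w'') (Read ''B'' (var ''w'')))"
  show ?thesis
    unfolding write_output_def
  proof (rule runs_Seq[OF runs_mono[OF runs_gather[OF rd(1) M] order_refl]])
    fix s\<^sub>1
    assume A: "(\<exists>ls. holds_list s\<^sub>1 ls \<and> distinct ls \<and> set ls = {v. v < n \<and> v \<in> ?W}) \<and>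
      (\<forall>y. y \<notin> {''L'', ''l'', ''w''} \<longrightarrow> s\<^sub>1 y = s y)"
    then obtain ls where ls: "holds_list s\<^sub>1 ls" "distinct ls" "set ls = ?W" unfolding W by blast
    have fr: "\<forall>y. y \<notin> {''L'', ''l'', ''w''} \<longrightarrow> s\<^sub>1 y = s y" using A by (rule conjunct2)
    have sub: "set ls \<subseteq> {..<n}" using ls(3) W by blast
    define m where "m = length ls"
    \<comment> \<open>The listed vertices are distinct vertices of the input, so costs in
      \<open>m\<close> can be charged to \<open>n\<close>.\<close>
    have mn: "m \<le> n"
      using card_mono[OF _ sub] distinct_card[OF ls(2)] by (simp add: m_def)
    have r1: "\<forall>i<n. s\<^sub>1 ''r'' i = i * n" and A1: "\<forall>i<n. \<forall>j<n. s\<^sub>1 ''A'' (i * n + j) = of_bool (adj i j)"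
      using fr rd by simp_all
    have "runs (Seq copy_matrix (Seq ?B (Write ''n'' (Const 0) (var ''l'')))) s\<^sub>1
      ((m * (m * 4 + 4) + 3) + (3 * (m * m) + 2 + 1)) ?Q"
    proof (rule runs_Seq[OF runs_mono[OF runs_copy_matrix[OF ls(1) sub r1 A1 m_def] order_refl] order_refl])
      fix s\<^sub>2
      assume s\<^sub>2: "s\<^sub>2 ''z'' 0 = m * m \<and>
        (\<forall>p<m * m. s\<^sub>2 ''B'' p = of_bool (adj (ls ! (p div m)) (ls ! (p mod m)))) \<and>
        (\<forall>y. y \<notin> {''B'', ''x'', ''z''} \<longrightarrow> s\<^sub>2 y = s\<^sub>1 y)"
      then have z: "s\<^sub>2 ''z'' 0 = m * m" by simp
      show "runs (Seq ?B (Write ''n'' (Const 0) (var ''l''))) s\<^sub>2 (3 * (m * m) + 2 + 1) ?Q"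
      proof (rule runs_Seq[OF runs_mono[OF runs_copy_back[of s\<^sub>2, unfolded z] order_refl] order_refl])
        fix s\<^sub>3
        assume s\<^sub>3: "(\<forall>p<m * m. s\<^sub>3 ''A'' p = s\<^sub>2 ''B'' p) \<and> (\<forall>y. y \<notin> {''A'', ''w''} \<longrightarrow> s\<^sub>3 y = s\<^sub>2 y)"
        have l: "s\<^sub>3 ''l'' 0 = m" "s\<^sub>3 ''k'' 0 = k"
          using s\<^sub>3 s\<^sub>2 fr ls(1) rd by (simp_all add: holds_list_def m_def)
        have a: "s\<^sub>3 ''A'' (i * m + j) = of_bool (adj (ls ! i) (ls ! j))" if ij: "i < m" "j < m" for i j
        proof -
          have "i * m + j < Suc i * m" using ij by simp
          also have "\<dots> \<le> m * m" using ij by (intro mult_le_mono1) simp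
          finally have "i * m + j < m * m" .
          moreover have "(i * m + j) div m = i" "(i * m + j) mod m = j" using ij by simp_all
          ultimately show ?thesis using s\<^sub>3 s\<^sub>2 by simp
        qed
        have "holds_input (length ls) k (\<lambda>i j. adj (ls ! i) (ls ! j))
          (s\<^sub>3(''n'' := (s\<^sub>3 ''n'')(0 := m)))"
          using l a by (simp add: holds_input_def m_def)
        then show "runs (Write ''n'' (Const 0) (var ''l'')) s\<^sub>3 1 ?Q"
          using ls l by auto
      qed
    qed
    moreover have "m * m \<le> n * n" using mn by (intro mult_le_mono)
    ultimately show "runs (Seq copy_matrix (Seq ?B (Write ''n'' (Const 0) (var ''l'')))) s\<^sub>1
      (7 * (n * n) + 4 * n + 6) ?Q"
      by (elim runs_mono) (use mn in \<open>simp_all add: algebra_simps\<close>)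
  qed simp
qed

section \<open>The kernelization\<close>

text \<open>If either guard fails, the input is small and is returned unchanged. The first guard
  makes the computation of the caps linear in \<open>n\<close>; the second bounds the enumeration
  per pair.\<close>

definition kernelize :: "nat \<Rightarrow> com" where
  "kernelize c = Cond (Less (var ''k'') (var ''n''))
     (Seq (compute_caps (c + 2))
       (Cond (Less (Read ''c'' (Const (c + 2))) (var ''n''))
         (Seq (Seq (compute_tables (c + 2)) compute_rows) (Seq (enumerate_pairs c) write_output)) Skip)) Skip"

lemma stores_iff_holds_input:
  "stores s (G, k) \<longleftrightarrow> holds_input (card (verts G)) k (adjacent G) s"
  by (simp add: stores_def holds_input_def of_bool_def Let_def)

text \<open>A relation between input and output, because the output is obtained only as the result
  of a run. The parameter is preserved.\<close>

definition kernel_of :: "nat \<Rightarrow> nat \<Rightarrow> nat graph \<times> nat \<Rightarrow> nat graph \<times> nat \<Rightarrow> bool" where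
  "kernel_of c A I I' \<longleftrightarrow> valid_instance I' \<and> snd I' = snd I \<and>
     (c_closed_vertex_deletion c I' \<longleftrightarrow> c_closed_vertex_deletion c I) \<and>
     card (verts (fst I')) \<le> A * snd I ^ (c + 2)"

lemma nest_time_bound: "\<exists>D. \<forall>k\<ge>1. nest_time c k r \<le> D * k ^ r"
proof (induction r)
  case 0
  \<comment> \<open>At \<open>r = 0\<close> the time is independent of \<open>k\<close>, so its
    value at \<open>k = 0\<close> serves as the constant.\<close>
  show ?case by (auto intro!: exI[of _ "nest_time c 0 0"])
next
  case (Suc r)
  then obtain D where D: "\<forall>k\<ge>1. nest_time c k r \<le> D * k ^ r" by blast
  show ?case
  proof (intro exI allI impI)
    fix k :: nat assume k: "k \<ge> 1"
    have 1: "1 \<le> k ^ r" using k by simp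
    have "k + c \<le> (1 + c) * k" using k by (cases k) auto
    moreover have "nest_time c k r + 3 \<le> (D + 3) * k ^ r"
      using D k 1 by (simp add: add_mult_distrib add_mono)
    ultimately have "(k + c) * (nest_time c k r + 3) \<le> ((1 + c) * k) * ((D + 3) * k ^ r)"
      by (rule mult_le_mono)
    also have "\<dots> = (1 + c) * (D + 3) * k ^ Suc r" by (simp add: algebra_simps)
    finally have "(k + c) * (nest_time c k r + 3) \<le> (1 + c) * (D + 3) * k ^ Suc r" .
    moreover have "2 \<le> 2 * k ^ Suc r" using k by simp
    ultimately show "nest_time c k (Suc r) \<le> ((1 + c) * (D + 3) + 2) * k ^ Suc r"
      by (simp only: nest_time.simps add_mult_distrib add_mono)
  qed
qed

lemma runs_kernelize:
  assumes c: "c \<ge> 1"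
  shows "\<exists>A B. \<forall>G k s. valid_instance (G, k) \<longrightarrow> input_store s (G, k) \<longrightarrow>
    runs (kernelize c) s (B * (card (verts G) ^ 3 + 1)) (\<lambda>s'. \<exists>I'. stores s' I' \<and> kernel_of c A (G, k) I')"
proof -
  define d where "d = c + 2"
  obtain C where C: "\<forall>k\<ge>1. cap d k d \<le> C * k ^ d" using cap_bound by blast
  obtain D where D: "\<forall>k\<ge>1. nest_time c k c \<le> D * k ^ c" using nest_time_bound by blast
  \<comment> \<open>One summand for each way to end: \<open>d * C\<close> for the vertices of kept
    tuples, \<open>C\<close> for \<open>n \<le> cap d k d\<close>, and 1 for
    \<open>n \<le> k\<close>.\<close>
  define A where "A = d * C + C + 1"
  \<comment> \<open>\<open>15\<close> adds up the coefficients of the terms with factor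
    \<open>d\<close> in the four phases, \<open>D\<close> belongs to the nested loops, and
    \<open>80\<close> generously covers the rest.\<close>
  define B where "B = 15 * d + D + 80"
  have "runs (kernelize c) s (B * (card (verts G) ^ 3 + 1)) (\<lambda>s'. \<exists>I'. stores s' I' \<and> kernel_of c A (G, k) I')"
    if val: "valid_instance (G, k)" and inp: "input_store s (G, k)" for G k s
  proof -
    define n where "n = card (verts G)"
    let ?Q = "\<lambda>s'. \<exists>I'. stores s' I' \<and> kernel_of c A (G, k) I'"
    have k: "k \<ge> 1" and G: "simple_graph G" "verts G = {..<n}"
      using val by (auto simp: valid_instance_def n_def)
    have hin: "holds_input n k (adjacent G) s"
      using inp by (simp add: input_store_def stores_iff_holds_input n_def)
    have same: "?Q s'" if "holds_input n k (adjacent G) s'" "n \<le> A * k ^ d" for s'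
    proof (intro exI conjI)
      show "stores s' (G, k)" using that by (simp add: stores_iff_holds_input n_def)
      show "kernel_of c A (G, k) (G, k)"
        using val that by (simp add: kernel_of_def n_def d_def)
    qed
    have Ck: "cap d k d \<le> C * k ^ d" using C k by blast
    have kd: "k \<le> k ^ d" using k by (simp add: d_def self_le_power)
    have AC: "C * k ^ d \<le> A * k ^ d" "k ^ d \<le> A * k ^ d" "d * (C * k ^ d) \<le> A * k ^ d"
      by (simp_all add: A_def algebra_simps)
    show ?thesis
    proof (cases "k < n")
      case False
      then have "n \<le> A * k ^ d" using kd AC by linarith
      then have "?Q s" by (rule same[OF hin])
      then show ?thesis
        using False hin by (simp add: kernelize_def holds_input_def B_def)
    next
      case kn: True
      have "runs (Seq (compute_caps d) (Cond (Less (Read ''c'' (Const d)) (var ''n''))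
         (Seq (Seq (compute_tables d) compute_rows) (Seq (enumerate_pairs c) write_output)) Skip)) s
         (B * (n ^ 3 + 1) - 1) ?Q"
      proof -
        have n1: "1 \<le> n" using kn by simp
        have n3: "n \<le> n ^ 3" "n * n \<le> n ^ 3" "1 \<le> n ^ 3"
          using n1 by (simp_all add: power3_eq_cube)
        have ks: "s ''k'' 0 = k" using hin by (simp add: holds_input_def)
        have zero: "s ''N'' i = 0" "s ''M'' i = 0" for i
          using inp by (simp_all add: input_store_def instance_cells_def)
        let ?T1 = "d * (3 * k + 4) + 2"
        let ?T2 = "d * (4 * n + 4) + 4 * n + 5"
        let ?T3 = "n * (n * (5 * n + 6 + D * n) + 4) + 2"
        let ?T4 = "7 * (n * n) + 9 * n + 9"
        have "runs (Seq (compute_caps d) (Cond (Less (Read ''c'' (Const d)) (var ''n''))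
         (Seq (Seq (compute_tables d) compute_rows) (Seq (enumerate_pairs c) write_output)) Skip)) s
          (?T1 + (1 + (?T2 + (?T3 + ?T4)))) ?Q"
        proof (rule runs_Seq[OF runs_mono[OF runs_compute_caps[where s = s and k = k, OF ks] order_refl] order_refl])
          fix s\<^sub>1
          assume s\<^sub>1: "(\<forall>j\<le>d. s\<^sub>1 ''c'' j = cap d k j) \<and> (\<forall>y. y \<notin> {''c'', ''w'', ''z''} \<longrightarrow> s\<^sub>1 y = s y)"
          then have hin1: "holds_input n k (adjacent G) s\<^sub>1"
            using hin by (simp add: holds_input_def)
          then have n': "s\<^sub>1 ''n'' 0 = n" by (simp add: holds_input_def)
          have cd: "s\<^sub>1 ''c'' d = cap d k d" using s\<^sub>1 by simp
          show "runs (Cond (Less (Read ''c'' (Const d)) (var ''n''))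
             (Seq (Seq (compute_tables d) compute_rows) (Seq (enumerate_pairs c) write_output)) Skip) s\<^sub>1
             (1 + (?T2 + (?T3 + ?T4))) ?Q"
          proof (cases "cap d k d < n")
            case False
            then have "n \<le> A * k ^ d" using Ck AC by linarith
            then have "?Q s\<^sub>1" by (rule same[OF hin1])
            then show ?thesis using False n' cd by simp
          next
            case True
            \<comment> \<open>Here the second guard pays off:
              \<open>k ^ c \<le> k ^ d \<le> cap d k d < n\<close>, so the nested loops for one pair
              take time linear in \<open>n\<close>.\<close>
            have "k ^ c \<le> k ^ d" using k by (intro power_increasing) (auto simp: d_def)
            also have "\<dots> \<le> cap d k d" by (rule power_le_cap) (simp add: d_def)
            finally have "D * k ^ c \<le> D * n" using True by (intro mult_le_mono2) linarith
            then have nt: "nest_time c k c \<le> D * n" using D k order_trans by blast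
            have "runs (Seq (Seq (compute_tables d) compute_rows) (Seq (enumerate_pairs c) write_output)) s\<^sub>1
              (?T2 + (?T3 + ?T4)) ?Q"
            proof (rule runs_Seq[OF runs_mono[OF runs_setup[of n k "adjacent G" s\<^sub>1 c, folded d_def] order_refl] order_refl])
              show "holds_input n k (adjacent G) s\<^sub>1" by (rule hin1)
              show "\<forall>j\<le>d. s\<^sub>1 ''c'' j = cap d k j" using s\<^sub>1 by (rule conjunct1)
              show "s\<^sub>1 ''N'' i = 0" "s\<^sub>1 ''M'' i = 0" for i using s\<^sub>1 zero by simp_all
              fix s\<^sub>2 assume sel: "selection c n k (adjacent G) {} s\<^sub>2"
              have t3: "n * (n * (5 * n + 6 + nest_time c k c) + 4) + 2 \<le> ?T3"
                using nt by (intro add_mono mult_le_mono order_refl)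
              show "runs (Seq (enumerate_pairs c) write_output) s\<^sub>2 (?T3 + ?T4) ?Q"
              proof (rule runs_Seq[OF runs_mono[OF runs_enumerate_pairs[OF sel] t3] order_refl])
                fix s\<^sub>3
                assume "\<exists>K. selection c n k (adjacent G) K s\<^sub>3 \<and>
                  (\<forall>u<n. \<forall>v<n. covers c k n (adjacent G) K u v)"
                then obtain K where K: "selection c n k (adjacent G) K s\<^sub>3"
                  "\<forall>u<n. \<forall>v<n. covers c k n (adjacent G) K u v" by blast
                have obs: "\<forall>t\<in>K. obstruction c n (adjacent G) t" and cp: "capped (c + 2) k K"
                  using K(1) by (simp_all add: selection_def)
                show "runs write_output s\<^sub>3 ?T4 ?Q"
                proof (rule runs_mono[OF runs_write_output[OF K(1)] order_refl], elim exE conjE)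
                  fix s\<^sub>4 ls
                  assume ls: "distinct ls" "set ls = \<Union> (set ` K)"
                    and h: "holds_input (length ls) k (\<lambda>i j. adjacent G (ls ! i) (ls ! j)) s\<^sub>4"
                  let ?I = "(induced G ls, k)"
                  have vs: "verts (induced G ls) = {..<length ls}" by (simp add: induced_def)
                  have "stores s\<^sub>4 ?I"
                    using h by (simp add: stores_iff_holds_input holds_input_def vs adjacent_induced[OF G(1)])
                  moreover have "length ls = card (\<Union> (set ` K))"
                    using distinct_card[OF ls(1)] ls(2) by simp
                  then have "length ls \<le> d * cap d k d"
                    using card_vertices_le[OF obs cp] by (simp add: d_def)
                  then have "length ls \<le> A * k ^ d"
                    using mult_le_mono2[OF Ck, of d] AC(3) by linarith
                  then have "kernel_of c A (G, k) ?I"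
                    using induced_equivalent[OF G obs cp K(2) c ls] simple_graph_induced k
                    by (simp add: kernel_of_def valid_instance_def vs d_def)
                  ultimately show "?Q s\<^sub>4" by blast
                qed
              qed
            qed
            then show ?thesis using True n' cd by simp
          qed
        qed
        moreover have "?T1 + (1 + (?T2 + (?T3 + ?T4))) \<le> B * (n ^ 3 + 1) - 1"
        proof -
          have 1: "d * k \<le> d * n ^ 3" "d * n \<le> d * n ^ 3" "d \<le> d * n ^ 3"
            using n3 kn by (simp_all add: mult_le_mono2)
          have 2: "n * (n * (5 * n + 6 + D * n) + 4) = 5 * n ^ 3 + 6 * (n * n) + D * n ^ 3 + 4 * n"
            by (simp add: algebra_simps power3_eq_cube)
          have 3: "B * (n ^ 3 + 1) = 15 * (d * n ^ 3) + D * n ^ 3 + 80 * n ^ 3 + (15 * d + D + 80)"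
            by (simp add: B_def algebra_simps)
          have 4: "?T1 = 3 * (d * k) + 4 * d + 2" "?T2 = 4 * (d * n) + 4 * d + 4 * n + 5"
            by (simp_all add: algebra_simps)
          show ?thesis unfolding 2 3 4 using 1 n3 by linarith
        qed
        ultimately show ?thesis by (elim runs_mono)
      qed
      then show ?thesis
        using kn hin unfolding kernelize_def d_def[symmetric] n_def[symmetric]
        by (simp add: holds_input_def B_def)
    qed
  qed
  then show ?thesis by blast
qed

text \<open>
  The kernelization is the function computed by the program; it is well defined as a function of
  the instance because the initial store is determined by the instance.
\<close>

lemma input_store_unique:
  assumes "input_store s (G, k)" "input_store s' (G, k)"
  shows "s = s'"
proof (intro ext)
  fix x i
  let ?n = "card (verts G)"
  show "s x i = s' x i"
  proof (cases "(x, i) \<in> instance_cells ?n")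
    case False
    then show ?thesis using assms by (simp add: input_store_def)
  next
    case True
    have h: "holds_input ?n k (adjacent G) s" "holds_input ?n k (adjacent G) s'"
      using assms by (simp_all add: input_store_def stores_iff_holds_input)
    have "s ''A'' i = s' ''A'' i" if i: "i < ?n * ?n"
    proof -
      have "0 < ?n" using i by (cases ?n) auto
      then have "i div ?n < ?n" "i mod ?n < ?n" using i by (auto simp: less_mult_imp_div_less)
      moreover have "i div ?n * ?n + i mod ?n = i" by simp
      ultimately show ?thesis using h unfolding holds_input_def by metis
    qed
    then show ?thesis using True h by (auto simp: instance_cells_def holds_input_def)
  qed
qed

text \<open>Needed to start the program at all: the value of the kernelization is read off a run
  from this store.\<close>

lemma input_store_exists: "\<exists>s. input_store s (G, k)"
proof -
  let ?n = "card (verts G)"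
  define s :: store where "s x i = (if (x, i) = (''n'', 0) then ?n else if (x, i) = (''k'', 0) then k
    else if x = ''A'' \<and> i < ?n * ?n then of_bool (adjacent G (i div ?n) (i mod ?n)) else 0)" for x i
  have "s ''A'' (i * ?n + j) = of_bool (adjacent G i j)" if ij: "i < ?n" "j < ?n" for i j
  proof -
    have "i * ?n + j < Suc i * ?n" using ij by simp
    also have "\<dots> \<le> ?n * ?n" using ij by (intro mult_le_mono1) simp
    finally show ?thesis using ij by (simp add: s_def)
  qed
  then have "holds_input ?n k (adjacent G) s" by (simp add: holds_input_def s_def)
  then have "input_store s (G, k)"
    by (auto simp: input_store_def stores_iff_holds_input instance_cells_def s_def)
  then show ?thesis by blast
qed

text \<open>The size of a kernel also counts edges and the parameter. Any function of
  \<open>k\<close> is allowed there, so bounding the edges by the power set is enough.\<close>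

lemma instance_size_le:
  assumes "valid_instance (G, k)" "card (verts G) \<le> b"
  shows "instance_size (G, k) \<le> b + 2 ^ b + k"
proof -
  have "finite (verts G)" "edges G \<subseteq> Pow (verts G)"
    using assms by (auto simp: valid_instance_def simple_graph_def)
  then have "card (edges G) \<le> 2 ^ card (verts G)"
    using card_mono[of "Pow (verts G)" "edges G"] by (simp add: card_Pow)
  also have "\<dots> \<le> 2 ^ b" using assms(2) by (intro power_increasing) auto
  finally show ?thesis using assms(2) by (simp add: instance_size_def)
qed

theorem theorem5:
  fixes c :: nat
  assumes "c \<ge> 2"
  shows "\<exists>(f :: nat graph \<times> nat \<Rightarrow> nat graph \<times> nat) (P :: com) (A :: nat) (B :: nat).
    is_kernel (c_closed_vertex_deletion c) f \<and>
    (\<forall>G k. valid_instance (G, k) \<longrightarrow> card (verts (fst (f (G, k)))) \<le> A * k ^ (c + 2)) \<and>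
    computes_within P f (\<lambda>(G, k).
      let n = card (verts G); m = card (edges G) in B * (n ^ 3 + n ^ 2 * m + 1))"
proof -
  have "c \<ge> 1" using assms by simp
  from runs_kernelize[OF this] obtain A B where run:
    "\<And>G k s. valid_instance (G, k) \<Longrightarrow> input_store s (G, k) \<Longrightarrow>
      runs (kernelize c) s (B * (card (verts G) ^ 3 + 1)) (\<lambda>s'. \<exists>I'. stores s' I' \<and> kernel_of c A (G, k) I')"
    by meson
  have "\<forall>I. \<exists>I'. valid_instance I \<longrightarrow> kernel_of c A I I' \<and>
    (\<forall>s. input_store s I \<longrightarrow>
      (\<exists>t s'. exec (kernelize c) s t s' \<and> stores s' I' \<and> t \<le> B * (card (verts (fst I)) ^ 3 + 1)))"
  proof
    fix I :: "nat graph \<times> nat"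
    obtain G k where I: "I = (G, k)" by (cases I)
    show "\<exists>I'. valid_instance I \<longrightarrow> kernel_of c A I I' \<and>
      (\<forall>s. input_store s I \<longrightarrow>
        (\<exists>t s'. exec (kernelize c) s t s' \<and> stores s' I' \<and> t \<le> B * (card (verts (fst I)) ^ 3 + 1)))"
    proof (cases "valid_instance I")
      case True
      \<comment> \<open>One run fixes the output for all input stores of the instance, since they
        coincide.\<close>
      obtain s where s: "input_store s (G, k)" using input_store_exists by blast
      from run[OF True[unfolded I] s] obtain t s' I' where
        "exec (kernelize c) s t s'" "t \<le> B * (card (verts G) ^ 3 + 1)" "stores s' I'" "kernel_of c A (G, k) I'"
        unfolding runs_def by blast
      then show ?thesis
        unfolding I using input_store_unique[OF s] by (intro exI[of _ I']) auto
    qed auto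
  qed
  then obtain f where f: "\<And>I. valid_instance I \<Longrightarrow> kernel_of c A I (f I)"
    "\<And>I s. valid_instance I \<Longrightarrow> input_store s I \<Longrightarrow>
      \<exists>t s'. exec (kernelize c) s t s' \<and> stores s' (f I) \<and> t \<le> B * (card (verts (fst I)) ^ 3 + 1)"
    by metis
  have "is_kernel (c_closed_vertex_deletion c) f"
    unfolding is_kernel_def
  proof (intro exI allI impI)
    fix G k assume "valid_instance (G, k)"
    from f(1)[OF this] have K: "kernel_of c A (G, k) (f (G, k))" .
    obtain G' where f': "f (G, k) = (G', k)"
      using K by (cases "f (G, k)") (auto simp: kernel_of_def)
    show "valid_instance (f (G, k)) \<and>
      (c_closed_vertex_deletion c (f (G, k)) \<longleftrightarrow> c_closed_vertex_deletion c (G, k)) \<and>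
      instance_size (f (G, k)) \<le> A * k ^ (c + 2) + 2 ^ (A * k ^ (c + 2)) + k"
      using K instance_size_le[of G' k "A * k ^ (c + 2)"] unfolding f' kernel_of_def by simp
  qed
  moreover have "\<forall>G k. valid_instance (G, k) \<longrightarrow> card (verts (fst (f (G, k)))) \<le> A * k ^ (c + 2)"
    using f(1) unfolding kernel_of_def by fastforce
  moreover have "computes_within (kernelize c) f (\<lambda>(G, k).
      let n = card (verts G); m = card (edges G) in B * (n ^ 3 + n ^ 2 * m + 1))"
    unfolding computes_within_def
  proof (intro allI impI)
    fix I :: "nat graph \<times> nat" and s assume I: "valid_instance I \<and> input_store s I"
    obtain G k where G: "I = (G, k)" by (cases I)
    obtain t s' where t: "exec (kernelize c) s t s'" "stores s' (f I)" "t \<le> B * (card (verts G) ^ 3 + 1)"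
      using f(2)[of I s] I G by auto
    have "B * (card (verts G) ^ 3 + 1) \<le> B * (card (verts G) ^ 3 + card (verts G) ^ 2 * card (edges G) + 1)"
      by (intro mult_le_mono2) simp
    with t(3) have "t \<le> B * (card (verts G) ^ 3 + card (verts G) ^ 2 * card (edges G) + 1)" by (rule order_trans)
    then show "\<exists>t s'. exec (kernelize c) s t s' \<and> stores s' (f I) \<and>
      t \<le> (case I of (G, k) \<Rightarrow>
        let n = card (verts G); m = card (edges G) in B * (n ^ 3 + n ^ 2 * m + 1))"
      using t(1,2) by (auto simp: G Let_def)
  qed
  ultimately show ?thesis by blast
qed

end
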